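(* Let $n\geq 2$, $N=\mathbb{R}^n$, and let $F^\alpha_t,F^\beta_t$ be two (possibly time- and position-dependent) Finsler metrics on $N$, with disjoint initial and arrival regions $A,B\subset N$. Let $p$ be a (possibly non-unique) optimal tack point at time $t_0\ge0$ for the one-tack-point travel from $A$ to $B$, using first $F^\alpha_t$ and then $F^\beta_t$. Let $\gamma_\alpha,\gamma_\beta$ be the optimal ($t$-parametrized) trajectories from $A$ (at $t=0$) to $p$ and from $p$ (at $t=t_0$) to $B$, respectively. Then the complete concatenated trajectory $\gamma_\alpha\cup\gamma_\beta$ satisfies Snell's law: $$\left(\frac{\partial F^\alpha_{t_0}}{\partial v^i}(\gamma_\alpha'(t_0^-))-\frac{\partial F^\beta_{t_0}}{\partial v^i}(\gamma_\beta'(t_0^+))\right)u^i=0,\qquad\forall u=(u^1,\ldots,u^n)\in T_p\eta,$$ (summation over $i=1,\dots,n$) for any interface $\eta$ passing through $p$ that divides $\gamma_\alpha$ and $\gamma_\beta$.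
   Context: A time-dependent Finsler metric $F_t$ on $N=\mathbb{R}^n$ is a function $F_t(v)\equiv F(t,x,v)\in[0,\infty)$ ($t\in\mathbb{R}$, $x\in N$, $v\in T_xN$), varying smoothly with $t$, continuous everywhere, smooth away from the zero vector, positive for $v\neq0$, positively homogeneous of degree 1 in $v$ (not necessarily symmetric), with the Hessian of $\frac12F_t^2$ in $v$ positive definite at every $v\ne0$. Standing assumption: each metric is bounded above by a time-independent Finsler metric and below by a complete time-independent Finsler metric. The regions $A,B$ are single points or compact embedded hypersurfaces of $N$. A trajectory with metric $F_t$, parametrized by time, is a regular piecewise smooth curve $\gamma(t)$ with $F_t(\gamma'(t))=1$. For a tack point $p\in N$, let $t_0\geq 0$ be the minimal time at which a trajectory with metric $F^\alpha_t$ departing from $A$ at $t=0$ arrives at $p$, and let $\mathcal{T}(p)\ge t_0$ be the minimal time at which a trajectory with metric $F^\beta_t$ departing from $p$ at time $t_0$ arrives at $B$. An optimal tack point is a point $p$ where $\mathcal{T}$ attains its global minimum; the corresponding optimal trajectories $\gamma_\alpha$ (on $[0,t_0]$) and $\gamma_\beta$ (on $[t_0,\mathcal{T}(p)]$) are ones realizing these minimal arrival times. $\gamma_\alpha'(t_0^-)$ and $\gamma_\beta'(t_0^+)$ are the one-sided velocities at $p$. An interface $\eta$ is a hypersurface of $N$ separating $N$ into two sides; it divides $\gamma_\alpha$ and $\gamma_\beta$ if $p\in\eta$ and $\gamma_\alpha$, $\gamma_\beta$ lie (apart from $p$) on different sides of $\eta$. *)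

theory Defs
  imports "HOL-Analysis.Analysis"
begin

section \<open>Smooth maps, hypersurfaces and piecewise smooth curves\<close>

text \<open>
  For open \<open>S\<close> in a finite-dimensional space this is \<open>C\<^sup>k\<close>: all iterated directional
  derivatives of order at most \<open>k\<close> exist as derivatives of Frechet differentiable maps and
  are continuous. Only open sets \<open>S\<close> are used below.
\<close>

fun Ck_on :: "nat \<Rightarrow> ('a::real_normed_vector \<Rightarrow> 'b::real_normed_vector) \<Rightarrow> 'a set \<Rightarrow> bool" where
  "Ck_on 0 f S \<longleftrightarrow> continuous_on S f"
| "Ck_on (Suc k) f S \<longleftrightarrow>
     (\<forall>x\<in>S. f differentiable (at x)) \<and>
     (\<forall>h. Ck_on k (\<lambda>x. frechet_derivative f (at x) h) S)"

definition smooth_on :: "('a::real_normed_vector \<Rightarrow> 'b::real_normed_vector) \<Rightarrow> 'a set \<Rightarrow> bool" where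
  "smooth_on f S \<longleftrightarrow> (\<forall>k. Ck_on k f S)"

definition partial_deriv :: "'n \<Rightarrow> (real ^ 'n \<Rightarrow> real) \<Rightarrow> real ^ 'n \<Rightarrow> real" where
  "partial_deriv i G v = deriv (\<lambda>s. G (v + s *\<^sub>R axis i 1)) 0"

definition hessian :: "(real ^ 'n \<Rightarrow> real) \<Rightarrow> real ^ 'n \<Rightarrow> real ^ 'n ^ 'n" where
  "hessian G v = (\<chi> i j. partial_deriv i (partial_deriv j G) v)"

text \<open>Embedded hypersurfaces without boundary, not necessarily closed or connected, given
  locally as regular level sets.\<close>

definition embedded_hypersurface :: "(real ^ 'n) set \<Rightarrow> bool" where
  "embedded_hypersurface S \<longleftrightarrow>
     (\<forall>x\<in>S. \<exists>U (f :: real ^ 'n \<Rightarrow> real). open U \<and> x \<in> U \<and> smooth_on f U \<and>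
        S \<inter> U = {y \<in> U. f y = 0} \<and>
        (\<forall>y\<in>S \<inter> U. \<exists>h. frechet_derivative f (at y) h \<noteq> 0))"

definition tangent_space :: "(real ^ 'n) set \<Rightarrow> real ^ 'n \<Rightarrow> (real ^ 'n) set" where
  "tangent_space S p = {u. \<exists>(c :: real \<Rightarrow> real ^ 'n) e. e > 0 \<and> smooth_on c {-e<..<e} \<and>
     c ` {-e<..<e} \<subseteq> S \<and> c 0 = p \<and> (c has_vector_derivative u) (at 0)}"

text \<open>
  On each closed piece \<open>{s i..s (Suc i)}\<close> the curve is the restriction of a regular curve that is
  smooth on an open neighbourhood of the piece, so that one-sided velocities exist everywhere and
  do not vanish. The parameter interval is nondegenerate (\<open>0 < k\<close> gives \<open>a < b\<close>), and
  continuity follows because consecutive pieces share an endpoint.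
\<close>

definition regular_piecewise_smooth :: "(real \<Rightarrow> real ^ 'n) \<Rightarrow> real \<Rightarrow> real \<Rightarrow> bool" where
  "regular_piecewise_smooth \<gamma> a b \<longleftrightarrow>
     (\<exists>(k::nat) (s :: nat \<Rightarrow> real). 0 < k \<and> s 0 = a \<and> s k = b \<and> (\<forall>i<k. s i < s (Suc i)) \<and>
        (\<forall>i<k. \<exists>U g. open U \<and> {s i..s (Suc i)} \<subseteq> U \<and> smooth_on g U \<and>
           (\<forall>t\<in>{s i..s (Suc i)}. \<gamma> t = g t \<and> vector_derivative g (at t) \<noteq> 0)))"

section \<open>Finsler metrics\<close>

text \<open>A metric is written \<open>F t x v\<close> with time \<open>t\<close>, point \<open>x\<close> and velocity \<open>v\<close>.\<close>

definition time_dependent_finsler ::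
    "(real \<Rightarrow> real ^ 'n \<Rightarrow> real ^ 'n \<Rightarrow> real) \<Rightarrow> bool" where
  "time_dependent_finsler F \<longleftrightarrow>
     (\<forall>t x v. 0 \<le> F t x v) \<and>
     continuous_on UNIV (\<lambda>(t, x, v). F t x v) \<and>
     smooth_on (\<lambda>(t, x, v). F t x v) {(t, x, v). v \<noteq> 0} \<and>
     (\<forall>t x v. v \<noteq> 0 \<longrightarrow> 0 < F t x v) \<and>
     (\<forall>t x v c. 0 < c \<longrightarrow> F t x (c *\<^sub>R v) = c * F t x v) \<and>
     (\<forall>t x v u. v \<noteq> 0 \<longrightarrow> u \<noteq> 0 \<longrightarrow>
        0 < u \<bullet> (hessian (\<lambda>w. (F t x w)\<^sup>2 / 2) v *v u))"

definition finsler_metric :: "(real ^ 'n \<Rightarrow> real ^ 'n \<Rightarrow> real) \<Rightarrow> bool" where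
  "finsler_metric G \<longleftrightarrow> time_dependent_finsler (\<lambda>_. G)"

definition finsler_length ::
    "(real ^ 'n \<Rightarrow> real ^ 'n \<Rightarrow> real) \<Rightarrow> (real \<Rightarrow> real ^ 'n) \<Rightarrow> real \<Rightarrow> real \<Rightarrow> real" where
  "finsler_length G \<gamma> a b = integral {a..b} (\<lambda>t. G (\<gamma> t) (vector_derivative \<gamma> (at t)))"

definition finsler_dist ::
    "(real ^ 'n \<Rightarrow> real ^ 'n \<Rightarrow> real) \<Rightarrow> real ^ 'n \<Rightarrow> real ^ 'n \<Rightarrow> real" where
  "finsler_dist G x y = Inf {finsler_length G \<gamma> a b | \<gamma> a b.
     regular_piecewise_smooth \<gamma> a b \<and> \<gamma> a = x \<and> \<gamma> b = y}"

text \<open>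
  The distance need not be symmetric. Completeness is forward completeness, which is implied by
  the stronger convention that asks for forward and backward completeness. Since \<open>finsler_dist\<close>
  induces the usual topology, convergence is the ordinary one.
\<close>

definition complete_finsler :: "(real ^ 'n \<Rightarrow> real ^ 'n \<Rightarrow> real) \<Rightarrow> bool" where
  "complete_finsler G \<longleftrightarrow>
     (\<forall>X :: nat \<Rightarrow> real ^ 'n.
        (\<forall>e>0. \<exists>M. \<forall>m\<ge>M. \<forall>n\<ge>m. finsler_dist G (X m) (X n) < e) \<longrightarrow> convergent X)"

definition finsler_bounds :: "(real \<Rightarrow> real ^ 'n \<Rightarrow> real ^ 'n \<Rightarrow> real) \<Rightarrow> bool" where
  "finsler_bounds F \<longleftrightarrow>
     (\<exists>G. finsler_metric G \<and> (\<forall>t x v. F t x v \<le> G x v)) \<and>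
     (\<exists>G. finsler_metric G \<and> complete_finsler G \<and> (\<forall>t x v. G x v \<le> F t x v))"

section \<open>Trajectories and arrival times\<close>

text \<open>
  At the finitely many corners nothing is demanded explicitly: by continuity the one-sided
  velocities there are unit as well. At the endpoints \<open>a\<close> and \<open>b\<close> the derivative is one-sided.
\<close>

definition trajectory ::
    "(real \<Rightarrow> real ^ 'n \<Rightarrow> real ^ 'n \<Rightarrow> real) \<Rightarrow> (real \<Rightarrow> real ^ 'n) \<Rightarrow> real \<Rightarrow> real \<Rightarrow> bool" where
  "trajectory F \<gamma> a b \<longleftrightarrow> regular_piecewise_smooth \<gamma> a b \<and>
     (\<forall>t\<in>{a..b}. \<gamma> differentiable (at t within {a..b}) \<longrightarrow>
        F t (\<gamma> t) (vector_derivative \<gamma> (at t within {a..b})) = 1)"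

text \<open>
  Times at which a trajectory departing from \<open>P\<close> at time \<open>s\<close> can arrive at \<open>Q\<close>. If \<open>P\<close> and \<open>Q\<close>
  meet, this includes immediate arrival at time \<open>s\<close>, which needs no trajectory.
\<close>

definition arrival_times ::
    "(real \<Rightarrow> real ^ 'n \<Rightarrow> real ^ 'n \<Rightarrow> real) \<Rightarrow> real \<Rightarrow> (real ^ 'n) set \<Rightarrow> (real ^ 'n) set \<Rightarrow> real set"
  where
  "arrival_times F s P Q = {t. (t = s \<and> P \<inter> Q \<noteq> {}) \<or>
     (\<exists>\<gamma>. trajectory F \<gamma> s t \<and> \<gamma> s \<in> P \<and> \<gamma> t \<in> Q)}"

text \<open>
  For metrics with \<open>finsler_bounds\<close> and nonempty compact \<open>P\<close> and \<open>Q\<close> the set of arrival times is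
  nonempty, bounded below by \<open>s\<close>, and the infimum is attained, so this is the minimal arrival time.
\<close>

definition minimal_arrival_time ::
    "(real \<Rightarrow> real ^ 'n \<Rightarrow> real ^ 'n \<Rightarrow> real) \<Rightarrow> real \<Rightarrow> (real ^ 'n) set \<Rightarrow> (real ^ 'n) set \<Rightarrow> real" where
  "minimal_arrival_time F s P Q = Inf (arrival_times F s P Q)"

definition tack_time ::
    "(real \<Rightarrow> real ^ 'n \<Rightarrow> real ^ 'n \<Rightarrow> real) \<Rightarrow> (real ^ 'n) set \<Rightarrow> real ^ 'n \<Rightarrow> real" where
  "tack_time F\<alpha> A q = minimal_arrival_time F\<alpha> 0 A {q}"

definition total_time ::
    "(real \<Rightarrow> real ^ 'n \<Rightarrow> real ^ 'n \<Rightarrow> real) \<Rightarrow> (real \<Rightarrow> real ^ 'n \<Rightarrow> real ^ 'n \<Rightarrow> real) \<Rightarrow>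
     (real ^ 'n) set \<Rightarrow> (real ^ 'n) set \<Rightarrow> real ^ 'n \<Rightarrow> real" where
  "total_time F\<alpha> F\<beta> A B q = minimal_arrival_time F\<beta> (tack_time F\<alpha> A q) {q} B"

definition optimal_tack_point ::
    "(real \<Rightarrow> real ^ 'n \<Rightarrow> real ^ 'n \<Rightarrow> real) \<Rightarrow> (real \<Rightarrow> real ^ 'n \<Rightarrow> real ^ 'n \<Rightarrow> real) \<Rightarrow>
     (real ^ 'n) set \<Rightarrow> (real ^ 'n) set \<Rightarrow> real ^ 'n \<Rightarrow> bool" where
  "optimal_tack_point F\<alpha> F\<beta> A B p \<longleftrightarrow>
     (\<forall>q. total_time F\<alpha> F\<beta> A B p \<le> total_time F\<alpha> F\<beta> A B q)"

definition admissible_region :: "(real ^ 'n) set \<Rightarrow> bool" where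
  "admissible_region R \<longleftrightarrow> (\<exists>a. R = {a}) \<or> (R \<noteq> {} \<and> compact R \<and> embedded_hypersurface R)"

section \<open>Interfaces\<close>

definition interface_with_sides ::
    "(real ^ 'n) set \<Rightarrow> (real ^ 'n) set \<Rightarrow> (real ^ 'n) set \<Rightarrow> bool" where
  "interface_with_sides \<eta> S1 S2 \<longleftrightarrow> embedded_hypersurface \<eta> \<and>
     open S1 \<and> open S2 \<and> S1 \<noteq> {} \<and> S2 \<noteq> {} \<and> S1 \<inter> S2 = {} \<and> - \<eta> = S1 \<union> S2"

definition interface_divides ::
    "(real ^ 'n) set \<Rightarrow> real ^ 'n \<Rightarrow> (real ^ 'n) set \<Rightarrow> (real ^ 'n) set \<Rightarrow> bool" where
  "interface_divides \<eta> p C1 C2 \<longleftrightarrow> p \<in> \<eta> \<and>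
     (\<exists>S1 S2. interface_with_sides \<eta> S1 S2 \<and> C1 - {p} \<subseteq> S1 \<and> C2 - {p} \<subseteq> S2)"

end

(*
  Suppose that for some direction u the derivative a of F\<alpha> along u at the incoming velocity were
  smaller than the derivative b of F\<beta> along u at the outgoing velocity. Push the tack point from p
  to q = p + \<rho> \<delta> u, dragging along only the parts of the two trajectories within time \<delta> of t0, by
  an amount that grows linearly up to the tack and decays linearly after it. To first order in \<rho>, and
  for small \<delta>, the first leg then arrives \<rho> \<delta> a later, while the second leg may start up to
  \<rho> \<delta> b later without reaching the end of its dragged part any later. So q has a strictly smaller
  total time, because whoever departs strictly earlier along a fixed path stays strictly earlier.
  Applying this to u and - u gives equality of the two covectors.

  The dragged curves are not unit speed; they are reparametrised by solving the scalar equation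
  \<tau>' = F \<tau> c c' for the clock, and compared with affine clocks.
*)

theory Submission
  imports Defs
begin


section \<open>Smooth maps\<close>

text \<open>Minimal arrival times are infima that may fail to be differentiable in the endpoint, so
  \<open>tack_time\<close> and \<open>total_time\<close> are never expanded: both are only bounded
  from above by explicit competitors. The obstacle is that a trajectory cannot wait.
  \<open>total_time\<close> makes the second leg start exactly at
  \<open>tack_time F\<alpha> A q\<close>, which may lie before the arrival of the constructed first
  leg, and the metric changes with time; an early start therefore has to be carried through all of
  the remaining path. For this reason the comparison results accept any departure strictly ahead of
  a reference clock and return an arrival strictly ahead of it. Strict inequalities absorb the error
  terms, which avoids differentiating solutions of the clock equation with respect to parameters.
  Confining the drag to time \<delta> around the tack makes the shifts of time and point of order
  \<rho> \<delta>, while the velocity changes by \<rho> u, so that only the fibre derivative at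
  \<open>t0\<close> matters to first order.\<close>

lemma Ck_on_cong:
  assumes "open S" "\<And>x. x \<in> S \<Longrightarrow> f x = g x" "Ck_on k f S"
  shows "Ck_on k g S"
  using assms(2,3)
proof (induction k arbitrary: f g)
  case 0
  then show ?case by (simp cong: continuous_on_cong)
next
  case (Suc k)
  have d: "(g has_derivative frechet_derivative f (at x)) (at x)" if "x \<in> S" for x
  proof -
    have "(f has_derivative frechet_derivative f (at x)) (at x)"
      using Suc.prems(2) that by (simp add: frechet_derivative_works)
    then show ?thesis
      using assms(1) that Suc.prems(1) by (rule has_derivative_transform_within_open)
  qed
  have "Ck_on k (\<lambda>x. frechet_derivative g (at x) h) S" for h
    by (rule Suc.IH[of "\<lambda>x. frechet_derivative f (at x) h"])
      (use Suc.prems(2) frechet_derivative_at[OF d] in auto)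
  then show ?case using d by (auto simp: differentiable_def)
qed

lemma Ck_on_SucD: "Ck_on (Suc k) f S \<Longrightarrow> Ck_on k f S"
proof (induction k arbitrary: f)
  case 0
  then show ?case
    by (auto intro!: continuous_at_imp_continuous_on differentiable_imp_continuous_within)
next
  case (Suc k)
  then show ?case by (metis Ck_on.simps(2))
qed

text \<open>The recursion refers to the chosen value \<open>frechet_derivative f (at x)\<close>;
  uniqueness of derivatives, together with \<open>Ck_on_cong\<close>, allows any explicit formula
  for the derivative in its place. The closure properties below all rest on this.\<close>

lemma Ck_on_SucI:
  assumes "open S" "\<And>x. x \<in> S \<Longrightarrow> (f has_derivative f' x) (at x)"
    and "\<And>h. Ck_on k (\<lambda>x. f' x h) S"
  shows "Ck_on (Suc k) f S"
proof -
  have "Ck_on k (\<lambda>x. frechet_derivative f (at x) h) S" for h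
    by (rule Ck_on_cong[OF assms(1) _ assms(3)[of h]])
      (use assms(2) frechet_derivative_at in metis)
  then show ?thesis using assms(2) by (auto simp: differentiable_def)
qed

lemma Ck_on_has_derivative:
  "Ck_on (Suc k) f S \<Longrightarrow> x \<in> S \<Longrightarrow> (f has_derivative frechet_derivative f (at x)) (at x)"
  by (simp add: frechet_derivative_works)

lemma Ck_on_const: "Ck_on k (\<lambda>x. c) S"
  by (induction k arbitrary: c) (auto simp: frechet_derivative_const)

lemma Ck_on_bounded_linear:
  assumes "open S" "bounded_linear f" shows "Ck_on k f S"
proof (cases k)
  case 0
  then show ?thesis using assms by (simp add: linear_continuous_on)
next
  case (Suc m)
  then show ?thesis
    using Ck_on_SucI[where f'="\<lambda>_. f"] assms Ck_on_const bounded_linear_imp_has_derivative by blast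
qed

lemma Ck_on_add:
  assumes "open S" "Ck_on k f S" "Ck_on k g S" shows "Ck_on k (\<lambda>x. f x + g x) S"
  using assms(2,3)
proof (induction k arbitrary: f g)
  case 0
  then show ?case by (auto intro!: continuous_intros)
next
  case (Suc k)
  show ?case
    by (rule Ck_on_SucI[OF assms(1), where f'="\<lambda>x h. frechet_derivative f (at x) h + frechet_derivative g (at x) h"])
      (use Suc in \<open>auto intro!: has_derivative_add Ck_on_has_derivative simp del: Ck_on.simps(2)\<close>, use Suc in auto)
qed

lemma Ck_on_sum:
  assumes "open S" "\<And>i. i \<in> I \<Longrightarrow> Ck_on k (f i) S" shows "Ck_on k (\<lambda>x. \<Sum>i\<in>I. f i x) S"
  using assms(2) by (induction I rule: infinite_finite_induct) (auto intro: Ck_on_const Ck_on_add assms(1))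

lemma Ck_on_bounded_linear_comp:
  assumes "open S" "bounded_linear L" "Ck_on k f S" shows "Ck_on k (\<lambda>x. L (f x)) S"
  using assms(3)
proof (induction k arbitrary: f)
  case 0
  then show ?case using assms(2) by (auto intro: bounded_linear.continuous_on)
next
  case (Suc k)
  show ?case
    by (rule Ck_on_SucI[OF assms(1), where f'="\<lambda>x h. L (frechet_derivative f (at x) h)"])
      (use Suc in \<open>auto intro!: bounded_linear.has_derivative[OF assms(2)] Ck_on_has_derivative simp del: Ck_on.simps(2)\<close>, use Suc in auto)
qed

lemma Ck_on_scaleR:
  assumes "open S" "Ck_on k f S" "Ck_on k g S" shows "Ck_on k (\<lambda>x. f x *\<^sub>R g x) S"
  using assms(2,3)
proof (induction k arbitrary: f g)
  case 0
  then show ?case by (auto intro!: continuous_intros)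
next
  case (Suc k)
  show ?case
  proof (rule Ck_on_SucI[OF assms(1)])
    show "((\<lambda>x. f x *\<^sub>R g x) has_derivative
        (\<lambda>h. f x *\<^sub>R frechet_derivative g (at x) h + frechet_derivative f (at x) h *\<^sub>R g x)) (at x)"
      if "x \<in> S" for x
      using Suc.prems that by (intro has_derivative_scaleR Ck_on_has_derivative)
    show "Ck_on k (\<lambda>x. f x *\<^sub>R frechet_derivative g (at x) h + frechet_derivative f (at x) h *\<^sub>R g x) S" for h
      using Suc by (intro Ck_on_add Suc.IH assms(1) Ck_on_SucD[of k f] Ck_on_SucD[of k g]) auto
  qed
qed

lemma Ck_on_Pair:
  assumes "open S" "Ck_on k f S" "Ck_on k g S" shows "Ck_on k (\<lambda>x. (f x, g x)) S"
  using assms(2,3)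
proof (induction k arbitrary: f g)
  case 0
  then show ?case by (auto intro!: continuous_intros)
next
  case (Suc k)
  show ?case
    by (rule Ck_on_SucI[OF assms(1), where f'="\<lambda>x h. (frechet_derivative f (at x) h, frechet_derivative g (at x) h)"])
      (use Suc in \<open>auto intro!: has_derivative_Pair Ck_on_has_derivative simp del: Ck_on.simps(2)\<close>, use Suc in auto)
qed

lemma linear_basis_expansion:
  fixes L :: "'a::euclidean_space \<Rightarrow> 'b::real_vector"
  assumes "linear L" shows "L h = (\<Sum>b\<in>Basis. (h \<bullet> b) *\<^sub>R L b)"
proof -
  have "L h = L (\<Sum>b\<in>Basis. (h \<bullet> b) *\<^sub>R b)" by (simp add: euclidean_representation)
  also have "\<dots> = (\<Sum>b\<in>Basis. (h \<bullet> b) *\<^sub>R L b)"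
    using assms by (simp add: linear_sum linear_scale)
  finally show ?thesis .
qed

text \<open>In the chain rule the derivative of \<open>f\<close> is taken in a direction that moves
  with \<open>x\<close>, whereas the recursion controls derivatives in fixed directions only.
  Expanding that direction in the basis gives a finite sum of products of fixed-direction
  derivatives, to which the induction hypothesis applies.\<close>

lemma Ck_on_compose:
  fixes f :: "'b::euclidean_space \<Rightarrow> 'c::real_normed_vector"
  assumes "open S" "open T" "g ` S \<subseteq> T" "Ck_on k f T" "Ck_on k g S"
  shows "Ck_on k (\<lambda>x. f (g x)) S"
  using assms(4,5)
proof (induction k arbitrary: f)
  case 0
  then show ?case using assms(3) by (auto intro: continuous_on_compose2)
next
  case (Suc k)
  show ?case
  proof (rule Ck_on_SucI[OF assms(1)])
    show "((\<lambda>x. f (g x)) has_derivative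
        (\<lambda>h. \<Sum>b\<in>Basis. (frechet_derivative g (at x) h \<bullet> b) *\<^sub>R frechet_derivative f (at (g x)) b)) (at x)"
      if "x \<in> S" for x
    proof -
      have f: "(f has_derivative frechet_derivative f (at (g x))) (at (g x))"
        using Suc.prems assms(3) that by (intro Ck_on_has_derivative) auto
      have "((\<lambda>x. f (g x)) has_derivative (\<lambda>h. frechet_derivative f (at (g x)) (frechet_derivative g (at x) h))) (at x)"
        using diff_chain_at[OF Ck_on_has_derivative[OF Suc.prems(2) that] f] by (simp add: o_def)
      then show ?thesis
        by (subst linear_basis_expansion[symmetric]) (use f has_derivative_linear in auto)
    qed
    show "Ck_on k (\<lambda>x. \<Sum>b\<in>Basis. (frechet_derivative g (at x) h \<bullet> b) *\<^sub>R frechet_derivative f (at (g x)) b) S" for h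
    proof (intro Ck_on_sum Ck_on_scaleR assms(1))
      fix b :: 'b
      show "Ck_on k (\<lambda>x. frechet_derivative g (at x) h \<bullet> b) S"
        using Suc.prems by (intro Ck_on_bounded_linear_comp[where L="\<lambda>y. y \<bullet> b"] assms(1) bounded_linear_inner_left) auto
      show "Ck_on k (\<lambda>x. frechet_derivative f (at (g x)) b) S"
        using Suc.prems by (intro Suc.IH Ck_on_SucD[of k g]) auto
    qed
  qed
qed

text \<open>The derivative is again built from \<open>inverse (f x)\<close> and a derivative of
  \<open>f\<close>, so the order rises by one at each step. It is needed because an inverse clock
  has derivative \<open>1 / F\<close>.\<close>

lemma Ck_on_inverse:
  fixes f :: "'a::real_normed_vector \<Rightarrow> real"
  assumes "open S" "Ck_on k f S" "\<And>x. x \<in> S \<Longrightarrow> f x \<noteq> 0"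
  shows "Ck_on k (\<lambda>x. inverse (f x)) S"
  using assms(2)
proof (induction k)
  case 0
  then show ?case using assms(3) by (auto intro!: continuous_intros)
next
  case (Suc k)
  show ?case
  proof (rule Ck_on_SucI[OF assms(1)])
    show "((\<lambda>x. inverse (f x)) has_derivative
        (\<lambda>h. (inverse (f x) *\<^sub>R inverse (f x)) *\<^sub>R - frechet_derivative f (at x) h)) (at x)"
      if "x \<in> S" for x
      by (rule derivative_eq_intros Ck_on_has_derivative[OF Suc.prems that] assms(3) that | simp add: field_simps)+
    show "Ck_on k (\<lambda>x. (inverse (f x) *\<^sub>R inverse (f x)) *\<^sub>R - frechet_derivative f (at x) h) S" for h
      using Suc by (intro Ck_on_scaleR Ck_on_bounded_linear_comp[where L=uminus] assms(1) bounded_linear_minus bounded_linear_ident Suc.IH Ck_on_SucD[of k f]) auto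
  qed
qed


section \<open>A global Picard theorem\<close>

text \<open>\<open>C / K * exp (K * (x - a))\<close> is an antiderivative of the bound on
  \<open>g\<close>, so subtracting \<open>G\<close> or \<open>- G\<close> from it leaves a
  nondecreasing function; \<open>\<sigma>\<close> is that sign. The gain of a factor
  \<open>1 / K\<close> is what makes Picard iteration contract.\<close>

lemma exponential_growth_bound_right:
  fixes G :: "real \<Rightarrow> real"
  assumes "K > 0" "C \<ge> 0" "G a = 0" "a \<le> s"
    and G: "\<And>x. a \<le> x \<Longrightarrow> (G has_real_derivative g x) (at x)"
    and g: "\<And>x. a \<le> x \<Longrightarrow> \<bar>g x\<bar> \<le> C * exp (K * (x - a))"
  shows "\<bar>G s\<bar> \<le> C / K * exp (K * (s - a))"
proof -
  have "\<sigma> * G s \<le> C / K * exp (K * (s - a))" if "\<bar>\<sigma>\<bar> = 1" for \<sigma> :: real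
  proof -
    let ?H = "\<lambda>x. C / K * exp (K * (x - a)) - \<sigma> * G x"
    have "?H a \<le> ?H s"
    proof (rule DERIV_nonneg_imp_nondecreasing[OF \<open>a \<le> s\<close>])
      fix x assume x: "a \<le> x" "x \<le> s"
      have "(?H has_real_derivative C * exp (K * (x - a)) - \<sigma> * g x) (at x)"
        using assms(1) by (auto intro!: derivative_eq_intros G x simp: field_simps)
      moreover have "\<sigma> * g x \<le> \<bar>g x\<bar>"
        using that by (metis abs_ge_self abs_mult mult_1)
      ultimately show "\<exists>y. (?H has_real_derivative y) (at x) \<and> 0 \<le> y"
        using g[OF x(1)] by (intro exI conjI) auto
    qed
    then have "C / K \<le> ?H s" using assms(3) by simp
    moreover have "C / K \<ge> 0" using assms(1,2) by simp
    ultimately show ?thesis by linarith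
  qed
  from this[of 1] this[of "-1"] show ?thesis by simp
qed

lemma exponential_growth_bound:
  fixes G :: "real \<Rightarrow> real"
  assumes "K > 0" "C \<ge> 0" "G a = 0"
    and G: "\<And>x. (G has_real_derivative g x) (at x)"
    and g: "\<And>x. \<bar>g x\<bar> \<le> C * exp (K * \<bar>x - a\<bar>)"
  shows "\<bar>G s\<bar> \<le> C / K * exp (K * \<bar>s - a\<bar>)"
proof (cases "a \<le> s")
  case True
  have "\<bar>g x\<bar> \<le> C * exp (K * (x - a))" if "a \<le> x" for x using g[of x] that by simp
  then show ?thesis
    using exponential_growth_bound_right[where G=G and g=g, OF assms(1-3) True] G True by simp
next
  case False
  \<comment> \<open>Reflection at \<open>a\<close> reduces \<open>s < a\<close> to the one-sided
    bound.\<close>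
  have "((\<lambda>x. G (2 * a - x)) has_real_derivative - g (2 * a - x)) (at x)" for x
    using DERIV_chain2[where f=G and g="\<lambda>x. 2 * a - x" and Db="-1" and s=UNIV, OF G]
    by (force intro!: derivative_eq_intros)
  moreover have "\<bar>- g (2 * a - x)\<bar> \<le> C * exp (K * (x - a))" if "a \<le> x" for x
    using g[of "2 * a - x"] that by simp
  ultimately show ?thesis
    using exponential_growth_bound_right[OF assms(1,2), of "\<lambda>x. G (2 * a - x)" a "2 * a - s" "\<lambda>x. - g (2 * a - x)"]
      False assms(3) by simp
qed

lemma antiderivative_UNIV:
  fixes h :: "real \<Rightarrow> real"
  assumes "continuous_on UNIV h"
  shows "\<exists>H. H a = 0 \<and> (\<forall>x. (H has_real_derivative h x) (at x))"
proof -
  let ?H = "\<lambda>u. LBINT y=ereal a..ereal u. h y"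
  have "(?H has_real_derivative h x) (at x)" for x
  proof -
  \<comment> \<open>The interval contains both \<open>a\<close> and \<open>x\<close> in its
    interior, so the derivative within it is two-sided, also for \<open>x < a\<close>.\<close>
  let ?l = "min a x - 1" and ?r = "max a x + 1"
  have "(?H has_vector_derivative h x) (at x within {?l..?r})"
    by (rule interval_integral_FTC2) (auto intro: continuous_on_subset[OF assms])
  then show ?thesis
    by (subst (asm) at_within_interior) (auto simp: has_real_derivative_iff_has_vector_derivative)
  qed
  then show ?thesis by (intro exI[of _ ?H]) simp
qed

text \<open>Picard iteration contracts in the sup norm after weighting by \<open>exp (- 2 L \<bar>s - a\<bar>)\<close>.\<close>

lemma picard_lindeloef_global:
  fixes f :: "real \<Rightarrow> real \<Rightarrow> real"
  assumes cont: "continuous_on UNIV (\<lambda>(s, t). f s t)"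
    and bound: "\<And>s t. \<bar>f s t\<bar> \<le> M"
    and lip: "\<And>s t t'. \<bar>f s t - f s t'\<bar> \<le> L * \<bar>t - t'\<bar>" and "L > 0"
  shows "\<exists>y. y a = y0 \<and> (\<forall>s. (y has_real_derivative f s (y s)) (at s))"
proof -
  \<comment> \<open>The contraction factor is \<open>L / K\<close>, so this choice makes it
    1/2.\<close>
  define K where "K = 2 * L"
  have K: "K > 0" using assms by (simp add: K_def)
  have M: "M \<ge> 0" using bound[of 0 0] by linarith
  \<comment> \<open>\<open>Y\<close> decodes a bounded continuous \<open>z\<close> into a candidate
    solution that may grow exponentially, so the ordinary sup norm on \<open>z\<close> is the
    weighted norm on candidates. \<open>P\<close> integrates \<open>f\<close> along the candidate
    and encodes the result; \<open>P z = z\<close> says that \<open>Y z\<close> solves the integral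
    equation.\<close>
  define Y where "Y z s = y0 + exp (K * \<bar>s - a\<bar>) * apply_bcontfun z s" for z s
  have Y: "continuous_on UNIV (Y z)" for z
    unfolding Y_def by (intro continuous_intros) auto
  have fY: "continuous_on UNIV (\<lambda>s. f s (Y z s))" for z
    using continuous_on_compose2[OF cont continuous_on_Pair[OF continuous_on_id Y]] by simp
  obtain J where J0: "\<And>z. J z a = 0" and J: "\<And>z x. (J z has_real_derivative f x (Y z x)) (at x)"
    using antiderivative_UNIV[OF fY, where a=a] by metis
  define P where "P z = Bcontfun (\<lambda>s. exp (- K * \<bar>s - a\<bar>) * J z s)" for z
  have P: "apply_bcontfun (P z) s = exp (- K * \<bar>s - a\<bar>) * J z s" for z s
  proof -
    have "continuous_on UNIV (J z)"
      using J by (meson DERIV_isCont continuous_at_imp_continuous_on)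
    moreover have "\<bar>exp (- K * \<bar>s - a\<bar>) * J z s\<bar> \<le> M / K" for s
    proof -
      have "\<bar>f x (Y z x)\<bar> \<le> M * exp (K * \<bar>x - a\<bar>)" for x
        using bound[of x "Y z x"] M K mult_left_mono[of 1 "exp (K * \<bar>x - a\<bar>)" M] by simp
      from exponential_growth_bound[OF K M J0 J this, of s] show ?thesis
        by (simp add: abs_mult exp_minus field_simps)
    qed
    ultimately have "(\<lambda>s. exp (- K * \<bar>s - a\<bar>) * J z s) \<in> bcontfun"
      by (intro bcontfun_normI[where b="M / K"]) (auto intro!: continuous_intros)
    then show ?thesis by (simp add: P_def Bcontfun_inverse)
  qed
  have "dist (P z) (P w) \<le> 1 / 2 * dist z w" for z w
  proof (rule dist_bound)
    fix s
    have d: "((\<lambda>x. J z x - J w x) has_real_derivative f x (Y z x) - f x (Y w x)) (at x)" for x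
      by (intro DERIV_diff J)
    have "\<bar>f x (Y z x) - f x (Y w x)\<bar> \<le> (L * dist z w) * exp (K * \<bar>x - a\<bar>)" for x
    proof -
      have "\<bar>f x (Y z x) - f x (Y w x)\<bar> \<le> L * \<bar>Y z x - Y w x\<bar>" by (rule lip)
      also have "Y z x - Y w x = exp (K * \<bar>x - a\<bar>) * (apply_bcontfun z x - apply_bcontfun w x)"
        by (simp add: Y_def algebra_simps)
      also have "\<bar>\<dots>\<bar> = exp (K * \<bar>x - a\<bar>) * dist (apply_bcontfun z x) (apply_bcontfun w x)"
        by (simp add: abs_mult dist_real_def)
      also have "\<dots> \<le> exp (K * \<bar>x - a\<bar>) * dist z w"
        by (intro mult_left_mono dist_bounded) auto
      finally show ?thesis using \<open>L > 0\<close> by (simp add: mult.commute mult.left_commute)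
    qed
    from exponential_growth_bound[OF K _ _ d this, of s] have
      "\<bar>J z s - J w s\<bar> \<le> L * dist z w / K * exp (K * \<bar>s - a\<bar>)"
      using J0 \<open>L > 0\<close> by simp
    then have "exp (- K * \<bar>s - a\<bar>) * \<bar>J z s - J w s\<bar> \<le> 1 / 2 * dist z w"
      using \<open>L > 0\<close> by (simp add: K_def exp_minus field_simps)
    then show "dist (apply_bcontfun (P z) s) (apply_bcontfun (P w) s) \<le> 1 / 2 * dist z w"
      by (simp add: P dist_real_def right_diff_distrib[symmetric] abs_mult)
  qed
  then obtain z where z: "P z = z"
    using banach_fix_type[of "1/2" P] by auto
  have "Y z s = y0 + J z s" for s
    using P[of z s] by (simp add: z Y_def exp_minus)
  then have "Y z = (\<lambda>s. y0 + J z s)" by blast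
  then have "(Y z has_real_derivative f s (Y z s)) (at s)" for s
    using J[of z s] by (auto intro!: derivative_eq_intros)
  moreover have "Y z a = y0" using J0 \<open>\<And>s. Y z s = y0 + J z s\<close> by simp
  ultimately show ?thesis by blast
qed

text \<open>Up to the first time \<open>s1\<close> with \<open>\<psi> s1 \<le> 0\<close>, the
  hypothesis makes \<open>exp (L * s) * \<psi> s\<close> nondecreasing, so it cannot drop from a
  positive value to a nonpositive one. With the absolute value, the hypothesis is just what a
  Lipschitz bound supplies.\<close>

lemma gronwall_positive:
  fixes \<psi> \<psi>' :: "real \<Rightarrow> real"
  assumes "\<And>s. s \<in> {a..b} \<Longrightarrow> (\<psi> has_real_derivative \<psi>' s) (at s)"
    and "\<And>s. s \<in> {a..b} \<Longrightarrow> \<psi>' s \<ge> - L * \<bar>\<psi> s\<bar>"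
    and "\<psi> a > 0" "a \<le> b"
  shows "\<psi> b > 0"
proof (rule ccontr)
  assume "\<not> \<psi> b > 0"
  have cont: "continuous_on {a..b} \<psi>"
    using assms(1) by (meson DERIV_isCont continuous_at_imp_continuous_on)
  define Z where "Z = {s \<in> {a..b}. \<psi> s \<le> 0}"
  have "closed Z"
    unfolding Z_def using continuous_closed_preimage[OF cont closed_real_atLeastAtMost, of "{..0}"]
    by (simp add: vimage_def Int_def conj_commute)
  moreover have "b \<in> Z" "bdd_below Z"
    using \<open>\<not> \<psi> b > 0\<close> assms(4) by (auto simp: Z_def bdd_below_def intro: exI[of _ a])
  ultimately have "Inf Z \<in> Z" by (intro closed_contains_Inf) auto
  define s1 where "s1 = Inf Z"
  have s1: "s1 \<in> Z" using \<open>Inf Z \<in> Z\<close> by (simp add: s1_def)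
  have pos: "\<psi> s > 0" if "a \<le> s" "s < s1" for s
    using that cInf_lower[of s Z] \<open>bdd_below Z\<close> s1 unfolding s1_def[symmetric]
    by (cases "s \<in> Z") (auto simp: Z_def)
  have "a \<le> s1" "s1 \<le> b" using s1 by (auto simp: Z_def)
  have "exp (L * a) * \<psi> a \<le> exp (L * s1) * \<psi> s1"
  proof (rule DERIV_nonneg_imp_increasing_open[OF \<open>a \<le> s1\<close>])
    fix x assume x: "a < x" "x < s1"
    then have "x \<in> {a..b}" using \<open>s1 \<le> b\<close> by auto
    then have "((\<lambda>s. exp (L * s) * \<psi> s) has_real_derivative exp (L * x) * (\<psi>' x + L * \<psi> x)) (at x)"
      by (auto intro!: derivative_eq_intros assms(1) simp: algebra_simps)
    moreover have "\<psi>' x + L * \<psi> x \<ge> 0"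
      using assms(2)[OF \<open>x \<in> {a..b}\<close>] pos[of x] x by simp
    ultimately show "\<exists>y. ((\<lambda>s. exp (L * s) * \<psi> s) has_real_derivative y) (at x) \<and> 0 \<le> y"
      by (intro exI[of _ "exp (L * x) * (\<psi>' x + L * \<psi> x)"] conjI) simp_all
  next
    show "continuous_on {a..s1} (\<lambda>s. exp (L * s) * \<psi> s)"
      using \<open>s1 \<le> b\<close> by (intro continuous_intros continuous_on_subset[OF cont]) auto
  qed
  moreover have "exp (L * a) * \<psi> a > 0" using assms(3) by simp
  moreover have "exp (L * s1) * \<psi> s1 \<le> 0" using s1 by (simp add: Z_def mult_nonneg_nonpos)
  ultimately show False by linarith
qed


section \<open>Following a given path at unit speed\<close>

lemma smooth_on_imp_Ck: "smooth_on f S \<Longrightarrow> Ck_on k f S"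
  by (simp add: smooth_on_def)

lemma smooth_on_has_derivative:
  "smooth_on f S \<Longrightarrow> x \<in> S \<Longrightarrow> (f has_derivative frechet_derivative f (at x)) (at x)"
  using Ck_on_has_derivative smooth_on_imp_Ck by blast

lemma smooth_on_continuous_on: "smooth_on f S \<Longrightarrow> continuous_on S f"
  using smooth_on_imp_Ck[of f S 0] by simp

lemma smooth_on_frechet_derivative:
  "smooth_on f S \<Longrightarrow> smooth_on (\<lambda>x. frechet_derivative f (at x) h) S"
  unfolding smooth_on_def by (metis Ck_on.simps(2))

lemma smooth_on_has_vector_derivative:
  assumes "smooth_on c U" "s \<in> U"
  shows "(c has_vector_derivative vector_derivative c (at s)) (at s)"
  using smooth_on_has_derivative[OF assms] differentiableI_vector vector_derivative_works
    differentiableI by blast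

lemma smooth_on_vector_derivative:
  assumes "open U" "smooth_on c U" shows "smooth_on (\<lambda>s. vector_derivative c (at s)) U"
  unfolding smooth_on_def
proof
  fix k
  show "Ck_on k (\<lambda>s. vector_derivative c (at s)) U"
  proof (rule Ck_on_cong[OF assms(1)])
    show "Ck_on k (\<lambda>s. frechet_derivative c (at s) 1) U"
      using assms(2) by (intro smooth_on_imp_Ck smooth_on_frechet_derivative)
    show "frechet_derivative c (at s) 1 = vector_derivative c (at s)" if "s \<in> U" for s
      using frechet_derivative_eq_vector_derivative[OF differentiableI[OF smooth_on_has_derivative[OF assms(2) that]]]
      by simp
  qed
qed

lemma open_nonzero_velocity: "open {(t::real, x::'a::real_normed_vector, v::'b::real_normed_vector). v \<noteq> 0}"
proof -
  have "{(t::real, x::'a, v::'b). v \<noteq> 0} = - ((\<lambda>z. snd (snd z)) -` {0})" by auto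
  moreover have "closed ((\<lambda>z::real \<times> 'a \<times> 'b. snd (snd z)) -` {0})"
    by (intro closed_vimage continuous_intros)
  ultimately show ?thesis by (simp add: open_Compl)
qed

lemma finsler_smooth:
  "time_dependent_finsler F \<Longrightarrow> smooth_on (\<lambda>(t, x, v). F t x v) {(t, x, v). v \<noteq> 0}"
  by (simp add: time_dependent_finsler_def)

lemma finsler_continuous_on_compose:
  assumes "time_dependent_finsler F" "continuous_on S t" "continuous_on S x" "continuous_on S v"
  shows "continuous_on S (\<lambda>z. F (t z) (x z) (v z))"
proof -
  have "continuous_on UNIV (\<lambda>(t, x, v). F t x v)"
    using assms(1) by (simp add: time_dependent_finsler_def)
  from continuous_on_compose2[OF this continuous_on_Pair[OF assms(2) continuous_on_Pair[OF assms(3,4)]]]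
  show ?thesis by simp
qed

lemma finsler_has_derivative:
  assumes "time_dependent_finsler F" "v \<noteq> 0"
  shows "((\<lambda>(t, x, v). F t x v) has_derivative
    frechet_derivative (\<lambda>(t, x, v). F t x v) (at (t, x, v))) (at (t, x, v))"
  using smooth_on_has_derivative[OF finsler_smooth[OF assms(1)]] assms(2) by auto

text \<open>One smooth piece of a trajectory. Smoothness on a neighbourhood of the closed interval
  makes all velocities two-sided derivatives, including those at the endpoints, and passes to
  subintervals.\<close>

definition unit_arc ::
    "(real \<Rightarrow> real ^ 'n \<Rightarrow> real ^ 'n \<Rightarrow> real) \<Rightarrow> (real \<Rightarrow> real ^ 'n) \<Rightarrow> real \<Rightarrow> real \<Rightarrow> bool" where
  "unit_arc F g a b \<longleftrightarrow> a < b \<and> (\<exists>U. open U \<and> {a..b} \<subseteq> U \<and> smooth_on g U) \<and>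
     (\<forall>t\<in>{a..b}. vector_derivative g (at t) \<noteq> 0 \<and> F t (g t) (vector_derivative g (at t)) = 1)"

lemma open_interval_enlarge:
  fixes V :: "real set"
  assumes "open V" "{a..b} \<subseteq> V" "a \<le> b"
  obtains a0 b0 where "a0 < a" "b < b0" "{a0..b0} \<subseteq> V"
proof -
  obtain e1 where e1: "e1 > 0" "cball a e1 \<subseteq> V" using open_contains_cball_eq[OF assms(1)] assms(2,3) by force
  obtain e2 where e2: "e2 > 0" "cball b e2 \<subseteq> V" using open_contains_cball_eq[OF assms(1)] assms(2,3) by force
  have "{a - e1..b + e2} \<subseteq> cball a e1 \<union> {a..b} \<union> cball b e2"
    by (auto simp: dist_real_def)
  then show ?thesis using that[of "a - e1" "b + e2"] e1 e2 assms(2) by (meson Un_least add_strict_increasing diff_gt_0_iff_gt less_add_same_cancel1 order_trans diff_less_eq)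
qed

text \<open>Following the path of \<open>c\<close> at unit speed means solving \<open>\<tau>' = F \<tau> c c'\<close> for the clock \<open>\<tau>\<close>; the
  affine clock \<open>l * s + d\<close> is a supersolution of this equation.\<close>

lemma unit_arc_ahead_of_clock:
  fixes F :: "real \<Rightarrow> real ^ 'n \<Rightarrow> real ^ 'n \<Rightarrow> real"
  assumes F: "time_dependent_finsler F" and bounds: "finsler_bounds F"
    and "a < b" "open U" "{a..b} \<subseteq> U" and c: "smooth_on c U"
    and nz: "\<And>s. s \<in> {a..b} \<Longrightarrow> vector_derivative c (at s) \<noteq> 0"
    and slow: "\<And>s. s \<in> {a..b} \<Longrightarrow> F (l * s + d) (c s) (vector_derivative c (at s)) \<le> l"
    and start: "ta < l * a + d"
  shows "\<exists>tb g. tb < l * b + d \<and> unit_arc F g ta tb \<and> g ta = c a \<and> g tb = c b"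
proof -
  define c' where "c' = (\<lambda>s. vector_derivative c (at s))"
  have sc': "smooth_on c' U" unfolding c'_def using assms by (intro smooth_on_vector_derivative)
  have contc: "continuous_on U c" "continuous_on U c'"
    using c sc' by (auto intro: smooth_on_continuous_on)
  have "open {s \<in> U. c' s \<noteq> 0}"
    using continuous_open_preimage[OF contc(2) \<open>open U\<close>, OF open_Compl[OF closed_singleton[of 0]]] by (simp add: vimage_def Int_def)
  moreover have "{a..b} \<subseteq> {s \<in> U. c' s \<noteq> 0}" using assms(5) nz by (auto simp: c'_def)
  \<comment> \<open>The margin beyond \<open>{a..b}\<close> provides the open time interval, around
    the final one, on which \<open>unit_arc\<close> demands smoothness of the reparametrised
    curve.\<close>
  ultimately obtain a0 b0 where ab: "a0 < a" "b < b0" and I: "{a0..b0} \<subseteq> {s \<in> U. c' s \<noteq> 0}"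
    using open_interval_enlarge[of "{s \<in> U. c' s \<noteq> 0}" a b] \<open>a < b\<close> by auto
  have IU: "{a0..b0} \<subseteq> U" and c'nz: "\<And>s. s \<in> {a0..b0} \<Longrightarrow> c' s \<noteq> 0" using I by auto
  \<comment> \<open>The time-independent upper metric bounds \<open>F\<close> along \<open>c\<close>
    uniformly in \<open>t\<close>, which keeps the clock from blowing up.\<close>
  obtain G where G: "finsler_metric G" "\<And>t x v. F t x v \<le> G x v"
    using bounds unfolding finsler_bounds_def by blast
  have Fpos: "0 < F t x v" if "v \<noteq> 0" for t x v
    using F that by (simp add: time_dependent_finsler_def)
  have Fhom: "F t x (k *\<^sub>R v) = k * F t x v" if "0 < k" for t x v k
    using F that by (simp add: time_dependent_finsler_def)
  have "continuous_on {a0..b0} (\<lambda>s. G (c s) (c' s))"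
    using G(1) unfolding finsler_metric_def
    by (rule finsler_continuous_on_compose) (auto intro: continuous_on_subset[OF contc(1) IU] continuous_on_subset[OF contc(2) IU])
  then have "bounded ((\<lambda>s. G (c s) (c' s)) ` {a0..b0})"
    by (intro compact_imp_bounded compact_continuous_image) auto
  then obtain M where M: "\<And>s. s \<in> {a0..b0} \<Longrightarrow> G (c s) (c' s) \<le> M"
    unfolding bounded_real using abs_le_D1 by blast
  have FM: "\<bar>F t (c s) (c' s)\<bar> \<le> M" if "s \<in> {a0..b0}" for t s
    using Fpos[OF c'nz[OF that], of t "c s"] G(2)[of t "c s" "c' s"] M[OF that] by linarith
  have M0: "M \<ge> 0" using FM[of a0] ab \<open>a < b\<close> by fastforce
  \<comment> \<open>\<open>F\<close> is Lipschitz in \<open>t\<close> only on bounded time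
    intervals. \<open>R\<close> bounds in advance every time that can occur: the clock moves at most
    \<open>M * (b0 - a0)\<close> away from \<open>ta\<close>, and the last two terms bound the
    affine clock on \<open>{a..b}\<close>.\<close>
  define R where "R = \<bar>ta\<bar> + M * (b0 - a0) + \<bar>l\<bar> * (\<bar>a\<bar> + \<bar>b\<bar>) + \<bar>d\<bar>"
  have R0: "R \<ge> 0" unfolding R_def using M0 ab \<open>a < b\<close> by simp
  define \<Phi> where "\<Phi> = (\<lambda>(t, x, v). F t x v)"
  define D where "D t s = frechet_derivative \<Phi> (at (t, c s, c' s)) (1, 0, 0)" for t s
  have "continuous_on ({-R..R} \<times> {a0..b0}) (\<lambda>z. D (fst z) (snd z))"
  proof -
    have "continuous_on {(t, x, v). v \<noteq> 0} (\<lambda>z. frechet_derivative \<Phi> (at z) (1, 0, 0))"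
      unfolding \<Phi>_def using F by (intro smooth_on_continuous_on smooth_on_frechet_derivative finsler_smooth)
    then show ?thesis
      unfolding D_def
    proof (rule continuous_on_compose2)
      show "continuous_on ({-R..R} \<times> {a0..b0}) (\<lambda>z. (fst z, c (snd z), c' (snd z)))"
        by (intro continuous_intros continuous_on_compose2[OF contc(1)] continuous_on_compose2[OF contc(2)])
          (use IU in auto)
    qed (use c'nz in auto)
  qed
  then have "bounded ((\<lambda>z. D (fst z) (snd z)) ` ({-R..R} \<times> {a0..b0}))"
    by (intro compact_imp_bounded compact_continuous_image compact_Times) auto
  then obtain L0 where L0: "\<And>t s. t \<in> {-R..R} \<Longrightarrow> s \<in> {a0..b0} \<Longrightarrow> \<bar>D t s\<bar> \<le> L0"
    unfolding bounded_real by fastforce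
  define L where "L = \<bar>L0\<bar> + 1"
  have L: "L > 0" by (simp add: L_def)
  have Lip: "\<bar>F t (c s) (c' s) - F t' (c s) (c' s)\<bar> \<le> L * \<bar>t - t'\<bar>"
    if "t \<in> {-R..R}" "t' \<in> {-R..R}" "s \<in> {a0..b0}" for t t' s
  proof -
    have "norm (F t (c s) (c' s) - F t' (c s) (c' s)) \<le> L * norm (t - t')"
    proof (rule field_differentiable_bound[where S="{-R..R}" and f'="\<lambda>t. D t s"])
      fix r assume r: "r \<in> {-R..R}"
      have "(\<Phi> has_derivative frechet_derivative \<Phi> (at (r, c s, c' s))) (at (r, c s, c' s))"
        unfolding \<Phi>_def by (rule finsler_has_derivative[OF F c'nz[OF that(3)]])
      moreover have "((\<lambda>t. (t, c s, c' s)) has_derivative (\<lambda>h. (h, 0, 0))) (at r)"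
        by (intro has_derivative_Pair has_derivative_ident has_derivative_const)
      ultimately
      have "((\<lambda>t. F t (c s) (c' s)) has_derivative (\<lambda>h. frechet_derivative \<Phi> (at (r, c s, c' s)) (h, 0, 0))) (at r)"
        using diff_chain_at[of "\<lambda>t. (t, c s, c' s)" "\<lambda>h. (h, 0, 0)" r \<Phi>] by (simp add: o_def \<Phi>_def)
      moreover have "frechet_derivative \<Phi> (at (r, c s, c' s)) (h, 0, 0) = D r s * h" for h
      proof -
        have "linear (frechet_derivative \<Phi> (at (r, c s, c' s)))"
          unfolding \<Phi>_def using finsler_has_derivative[OF F c'nz[OF that(3)]] has_derivative_linear by blast
        from linear_scale[OF this, of h "(1, 0, 0)"] show ?thesis by (simp add: D_def)
      qed
      ultimately have "((\<lambda>t. F t (c s) (c' s)) has_field_derivative D r s) (at r)"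
        by (simp add: has_field_derivative_def)
      then show "((\<lambda>t. F t (c s) (c' s)) has_field_derivative D r s) (at r within {-R..R})"
        by (rule has_field_derivative_at_within)
      show "norm (D r s) \<le> L" using L0[OF r that(3)] by (simp add: L_def)
    qed (use that in auto)
    then show ?thesis by simp
  qed
  \<comment> \<open>Clamping place and time to the box makes the right-hand side globally bounded
    and Lipschitz, as the Picard theorem requires. By \<open>\<tau>R\<close> the clamps are inactive
    along the solution over \<open>{a0..b0}\<close>, where the clock equation for \<open>F\<close>
    itself is thus solved.\<close>
  define q where "q s = max a0 (min b0 s)" for s
  define r where "r t = max (- R) (min R t)" for t
  have q: "q s \<in> {a0..b0}" for s using ab \<open>a < b\<close> by (auto simp: q_def)
  have r: "r t \<in> {-R..R}" for t using R0 by (auto simp: r_def)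
  have rlip: "\<bar>r t - r t'\<bar> \<le> \<bar>t - t'\<bar>" for t t' by (auto simp: r_def max_def min_def)
  define f where "f s t = F (r t) (c (q s)) (c' (q s))" for s t
  have "continuous_on UNIV (\<lambda>(s, t). f s t)"
  proof -
    have qc: "continuous_on UNIV (\<lambda>z. q (fst z))" "continuous_on UNIV (\<lambda>z. r (snd z))"
      unfolding q_def r_def by (intro continuous_intros)+
    show ?thesis unfolding f_def case_prod_beta
      using q IU by (intro finsler_continuous_on_compose[OF F] qc continuous_on_compose2[OF contc(1)] continuous_on_compose2[OF contc(2)]) auto
  qed
  moreover have "\<bar>f s t\<bar> \<le> M" for s t unfolding f_def by (rule FM[OF q])
  moreover have "\<bar>f s t - f s t'\<bar> \<le> L * \<bar>t - t'\<bar>" for s t t'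
    unfolding f_def using Lip[OF r[of t] r[of t'] q[of s]] rlip[of t t'] L
    by (meson mult_left_mono order_trans less_imp_le)
  ultimately obtain \<tau> where \<tau>a: "\<tau> a = ta" and \<tau>: "\<And>s. (\<tau> has_real_derivative f s (\<tau> s)) (at s)"
    using picard_lindeloef_global[of f M L a ta] L by blast
  have fpos: "f s t > 0" for s t unfolding f_def by (intro Fpos c'nz q)
  have mono: "strict_mono \<tau>"
    using DERIV_pos_imp_increasing[of _ _ \<tau>] \<tau> fpos by (metis strict_monoI)
  have contt: "isCont \<tau> s" for s using \<tau> DERIV_isCont by blast
  have \<tau>R: "\<tau> s \<in> {-R..R}" if "s \<in> {a0..b0}" for s
  proof -
    have "norm (\<tau> s - \<tau> a) \<le> M * norm (s - a)"
      by (rule field_differentiable_bound[where S=UNIV and f'="\<lambda>s. f s (\<tau> s)"])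
        (use \<tau> FM[OF q] in \<open>auto simp: f_def\<close>)
    also have "\<dots> \<le> M * (b0 - a0)" using M0 that ab \<open>a < b\<close> by (intro mult_left_mono) auto
    finally have "\<bar>\<tau> s\<bar> \<le> \<bar>ta\<bar> + M * (b0 - a0)" using \<tau>a by simp
    also have "\<dots> \<le> R" unfolding R_def by simp
    finally show ?thesis by auto
  qed
  have f_eq: "f s t = F t (c s) (c' s)" if "s \<in> {a0..b0}" "t \<in> {-R..R}" for s t
    using that by (auto simp: f_def q_def r_def min_def max_def)

  have early: "\<tau> b < l * b + d"
  proof -
    have yR: "l * s + d \<in> {-R..R}" if "s \<in> {a..b}" for s
    proof -
      have "\<bar>l * s + d\<bar> \<le> \<bar>l\<bar> * \<bar>s\<bar> + \<bar>d\<bar>" by (metis abs_mult abs_triangle_ineq)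
      also have "\<bar>l\<bar> * \<bar>s\<bar> \<le> \<bar>l\<bar> * (\<bar>a\<bar> + \<bar>b\<bar>)" using that by (intro mult_left_mono) auto
      finally have "\<bar>l * s + d\<bar> \<le> \<bar>l\<bar> * (\<bar>a\<bar> + \<bar>b\<bar>) + \<bar>d\<bar>" by simp
      also have "\<dots> \<le> R" unfolding R_def using M0 ab \<open>a < b\<close> by simp
      finally show ?thesis by auto
    qed
    \<comment> \<open>The lead over the affine clock satisfies \<open>\<psi>' = l - f s (\<tau> s)
      \<ge> f s (l * s + d) - f s (\<tau> s) \<ge> - L * \<bar>\<psi>\<bar>\<close>, the first
      inequality being \<open>slow\<close>.\<close>
    have "l * b + d - \<tau> b > 0"
    proof (rule gronwall_positive[where \<psi>="\<lambda>s. l * s + d - \<tau> s" and \<psi>'="\<lambda>s. l - f s (\<tau> s)" and a=a and L=L])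
      fix s assume s: "s \<in> {a..b}"
      then have s': "s \<in> {a0..b0}" using ab by auto
      show "((\<lambda>s. l * s + d - \<tau> s) has_real_derivative l - f s (\<tau> s)) (at s)"
        by (auto intro!: derivative_eq_intros \<tau>)
      have "\<bar>f s (l * s + d) - f s (\<tau> s)\<bar> \<le> L * \<bar>l * s + d - \<tau> s\<bar>"
        using Lip[OF yR[OF s] \<tau>R[OF s'] s'] unfolding f_eq[OF s' yR[OF s]] f_eq[OF s' \<tau>R[OF s']] .
      moreover have "f s (l * s + d) \<le> l" using slow[OF s] f_eq[OF s' yR[OF s]] by (simp add: c'_def)
      ultimately show "- L * \<bar>l * s + d - \<tau> s\<bar> \<le> l - f s (\<tau> s)" by simp
    qed (use start \<tau>a \<open>a < b\<close> in auto)
    then show ?thesis by simp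
  qed

  define \<sigma> where "\<sigma> = inv \<tau>"
  have \<sigma>\<tau>: "\<sigma> (\<tau> s) = s" for s
    unfolding \<sigma>_def using mono by (simp add: strict_mono_imp_inj_on inv_f_f)
  define V where "V = {\<tau> a0<..<\<tau> b0}"
  have V: "\<exists>s. s \<in> {a0<..<b0} \<and> t = \<tau> s" if "t \<in> V" for t
  proof -
    have "\<exists>s\<ge>a0. s \<le> b0 \<and> \<tau> s = t"
      using that contt ab \<open>a < b\<close> by (intro IVT) (auto simp: V_def)
    then obtain s where s: "a0 \<le> s" "s \<le> b0" "\<tau> s = t" by blast
    then have "s \<noteq> a0" "s \<noteq> b0" using that by (auto simp: V_def)
    then show ?thesis using s by force
  qed
  have \<tau>\<sigma>: "\<tau> (\<sigma> t) = t" and \<sigma>I: "\<sigma> t \<in> {a0..b0}" if "t \<in> V" for t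
    using V[OF that] \<sigma>\<tau> by auto
  have d\<sigma>: "(\<sigma> has_real_derivative inverse (F t (c (\<sigma> t)) (c' (\<sigma> t)))) (at t)" if "t \<in> V" for t
  proof (rule DERIV_inverse_function[where f=\<tau> and a="\<tau> a0" and b="\<tau> b0"])
    have "f (\<sigma> t) (\<tau> (\<sigma> t)) = F t (c (\<sigma> t)) (c' (\<sigma> t))"
      using f_eq[OF \<sigma>I[OF that] \<tau>R[OF \<sigma>I[OF that]]] \<tau>\<sigma>[OF that] by simp
    then show "(\<tau> has_real_derivative F t (c (\<sigma> t)) (c' (\<sigma> t))) (at (\<sigma> t))"
      using \<tau>[of "\<sigma> t"] by simp
    show "F t (c (\<sigma> t)) (c' (\<sigma> t)) \<noteq> 0" using Fpos[OF c'nz[OF \<sigma>I[OF that]]] by (metis less_irrefl)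
    show "isCont \<sigma> t"
      using isCont_inverse_function[where f=\<tau> and g=\<sigma> and x="\<sigma> t" and d=1] \<sigma>\<tau> contt \<tau>\<sigma>[OF that] by simp
  qed (use that \<tau>\<sigma> in \<open>auto simp: V_def\<close>)
  have \<sigma>U: "\<sigma> ` V \<subseteq> U" using \<sigma>I IU by blast
  have oV: "open V" by (simp add: V_def)
  \<comment> \<open>Bootstrapping: the derivative of \<open>\<sigma>\<close> is a smooth function of
    \<open>t\<close> and \<open>\<sigma> t\<close>, so each order of differentiability yields the
    next.\<close>
  have Ck\<sigma>: "Ck_on k \<sigma> V" for k
  proof (induction k)
    case 0
    show ?case using d\<sigma> by (auto intro!: continuous_at_imp_continuous_on DERIV_isCont)
  next
    case (Suc k)
    show ?case
    proof (rule Ck_on_SucI[OF oV])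
      show "(\<sigma> has_derivative (\<lambda>h. h *\<^sub>R inverse (F t (c (\<sigma> t)) (c' (\<sigma> t))))) (at t)" if "t \<in> V" for t
        using d\<sigma>[OF that] by (simp add: has_field_derivative_def mult_commute_abs)
      fix h
      have "Ck_on k (\<lambda>t. c (\<sigma> t)) V" "Ck_on k (\<lambda>t. c' (\<sigma> t)) V"
        by (rule Ck_on_compose[OF oV \<open>open U\<close> \<sigma>U smooth_on_imp_Ck[OF c] Suc],
            rule Ck_on_compose[OF oV \<open>open U\<close> \<sigma>U smooth_on_imp_Ck[OF sc'] Suc])
      then have "Ck_on k (\<lambda>t. (t, c (\<sigma> t), c' (\<sigma> t))) V"
        by (intro Ck_on_Pair[OF oV Ck_on_bounded_linear[OF oV bounded_linear_ident]] Ck_on_Pair[OF oV])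
      moreover have "(\<lambda>t. (t, c (\<sigma> t), c' (\<sigma> t))) ` V \<subseteq> {(t, x, v). v \<noteq> 0}"
        using \<sigma>I c'nz by auto
      ultimately have "Ck_on k (\<lambda>t. \<Phi> (t, c (\<sigma> t), c' (\<sigma> t))) V"
        unfolding \<Phi>_def
        by (intro Ck_on_compose[OF oV open_nonzero_velocity _ smooth_on_imp_Ck[OF finsler_smooth[OF F]]])
      then have "Ck_on k (\<lambda>t. F t (c (\<sigma> t)) (c' (\<sigma> t))) V" by (simp add: \<Phi>_def)
      then show "Ck_on k (\<lambda>t. h *\<^sub>R inverse (F t (c (\<sigma> t)) (c' (\<sigma> t)))) V"
        using Fpos c'nz \<sigma>I by (intro Ck_on_scaleR oV Ck_on_const Ck_on_inverse) (metis less_irrefl)+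
    qed
  qed
  define g where "g t = c (\<sigma> t)" for t
  have "smooth_on g V"
    unfolding smooth_on_def g_def
    by (intro allI Ck_on_compose[OF oV \<open>open U\<close> \<sigma>U smooth_on_imp_Ck[OF c] Ck\<sigma>])
  moreover have "{\<tau> a..\<tau> b} \<subseteq> V"
    using strict_monoD[OF mono ab(1)] strict_monoD[OF mono ab(2)] by (auto simp: V_def)
  moreover have "\<tau> a < \<tau> b" using mono \<open>a < b\<close> by (simp add: strict_mono_less)
  \<comment> \<open>The velocity of \<open>g\<close> is that of \<open>c\<close> divided by its
    \<open>F\<close>-length, so unit speed follows from positive homogeneity.\<close>
  moreover have "vector_derivative g (at t) \<noteq> 0 \<and> F t (g t) (vector_derivative g (at t)) = 1" if "t \<in> V" for t
  proof -
    let ?k = "F t (c (\<sigma> t)) (c' (\<sigma> t))"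
    have k: "?k > 0" using Fpos c'nz \<sigma>I that by blast
    have "(c has_vector_derivative c' (\<sigma> t)) (at (\<sigma> t))"
      unfolding c'_def using \<sigma>I[OF that] IU by (intro smooth_on_has_vector_derivative[OF c]) auto
    from vector_diff_chain_at[of \<sigma>, OF _ this, of "inverse ?k"] d\<sigma>[OF that]
    have "(g has_vector_derivative inverse ?k *\<^sub>R c' (\<sigma> t)) (at t)"
      by (simp add: has_real_derivative_iff_has_vector_derivative o_def g_def[abs_def])
    then have "vector_derivative g (at t) = inverse ?k *\<^sub>R c' (\<sigma> t)" by (rule vector_derivative_at)
    then show ?thesis using k c'nz[OF \<sigma>I[OF that]] Fhom[of "inverse ?k" t "c (\<sigma> t)" "c' (\<sigma> t)"] by (simp add: g_def)
  qed
  ultimately have "unit_arc F g (\<tau> a) (\<tau> b)"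
    unfolding unit_arc_def using oV by blast
  then show ?thesis using early \<tau>a by (intro exI[of _ "\<tau> b"] exI[of _ g]) (auto simp: g_def \<sigma>\<tau>)
qed


section \<open>Chains of unit speed arcs\<close>

lemma unit_arc_subinterval:
  assumes "unit_arc F g a b" "a \<le> a'" "a' < b'" "b' \<le> b"
  shows "unit_arc F g a' b'"
proof -
  have "{a'..b'} \<subseteq> {a..b}" using assms(2,4) by auto
  then show ?thesis using assms unfolding unit_arc_def by blast
qed

lemma unit_arc_has_vector_derivative:
  assumes "unit_arc F g a b" "t \<in> {a..b}"
  shows "(g has_vector_derivative vector_derivative g (at t)) (at t)"
  using assms smooth_on_has_vector_derivative unfolding unit_arc_def by blast

lemma vector_derivative_within_ivl:
  assumes "(f has_vector_derivative D) (at t within {a..b})" "t \<in> {a..b}" "a < b"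
  shows "vector_derivative f (at t within {a..b}) = D"
  using assms vector_derivative_within_cbox[of a b t f D] by simp

text \<open>A relation between events, that is pairs of time and place. Its closure admits corners
  and postpones all gluing of curves; the reflexive closure also covers a leg that has no further
  arc.\<close>

definition unit_step ::
    "(real \<Rightarrow> real ^ 'n \<Rightarrow> real ^ 'n \<Rightarrow> real) \<Rightarrow> real \<times> (real ^ 'n) \<Rightarrow> real \<times> (real ^ 'n) \<Rightarrow> bool" where
  "unit_step F P Q \<longleftrightarrow>
     (\<exists>g. unit_arc F g (fst P) (fst Q) \<and> g (fst P) = snd P \<and> g (fst Q) = snd Q)"

text \<open>A unit speed arc satisfies the clock hypothesis with equality for the identity clock
  \<open>l = 1\<close>, \<open>d = 0\<close>, so the same path can be followed from an earlier start
  without losing the lead.\<close>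

lemma unit_step_depart_earlier:
  assumes "time_dependent_finsler F" "finsler_bounds F" "unit_step F P Q" "a' < fst P"
  shows "\<exists>b'<fst Q. unit_step F (a', snd P) (b', snd Q)"
proof -
  obtain g where g: "unit_arc F g (fst P) (fst Q)" "g (fst P) = snd P" "g (fst Q) = snd Q"
    using assms(3) unfolding unit_step_def by blast
  obtain U where U: "open U" "{fst P..fst Q} \<subseteq> U" "smooth_on g U" "fst P < fst Q"
    using g(1) unfolding unit_arc_def by blast
  have "\<exists>tb g'. tb < 1 * fst Q + 0 \<and> unit_arc F g' a' tb \<and> g' a' = g (fst P) \<and> g' tb = g (fst Q)"
    by (rule unit_arc_ahead_of_clock[OF assms(1,2) U(4,1-3)])
      (use g(1) assms(4) in \<open>auto simp: unit_arc_def\<close>)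
  then show ?thesis using g unfolding unit_step_def by auto
qed

lemma unit_chain_depart_earlier:
  assumes "time_dependent_finsler F" "finsler_bounds F" "(unit_step F)\<^sup>*\<^sup>* P Q" "a' < fst P"
  shows "\<exists>b'<fst Q. (unit_step F)\<^sup>*\<^sup>* (a', snd P) (b', snd Q)"
  using assms(3)
proof (induction rule: rtranclp_induct)
  case base
  then show ?case using assms(4) by blast
next
  case (step Q R)
  then obtain b' where b': "b' < fst Q" "(unit_step F)\<^sup>*\<^sup>* (a', snd P) (b', snd Q)" by blast
  obtain c' where "c' < fst R" "unit_step F (b', snd Q) (c', snd R)"
    using unit_step_depart_earlier[OF assms(1,2) step.hyps(2) b'(1)] by blast
  then show ?case using b'(2) by (meson rtranclp.rtrancl_into_rtrancl)
qed

lemma partition_mono: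
  fixes s :: "nat \<Rightarrow> real"
  assumes "\<And>i. i < k \<Longrightarrow> s i < s (Suc i)" "i \<le> j" "j \<le> k"
  shows "s i \<le> s j"
  using assms(2,3)
proof (induction j rule: dec_induct)
  case (step n)
  then show ?case using assms(1)[of n] by simp
qed simp

lemma regular_piecewise_smooth_less:
  assumes "regular_piecewise_smooth \<gamma> a b" shows "a < b"
proof -
  obtain k s where s: "0 < k" "s 0 = a" "s k = b" "\<And>i. i < k \<Longrightarrow> s i < s (Suc i)"
    using assms unfolding regular_piecewise_smooth_def by blast
  then show ?thesis using partition_mono[of k s "Suc 0" k] s(4)[of 0] by simp
qed

text \<open>\<open>trajectory\<close> prescribes unit speed only where the curve is differentiable
  within \<open>{a..b}\<close>. Inside a piece this gives unit speed of the smooth extension, and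
  continuity of \<open>F\<close> carries it to the ends of the piece, hence to the one-sided
  velocities at corners.\<close>

lemma trajectory_arcs:
  assumes F: "time_dependent_finsler F" and "trajectory F \<gamma> a b"
  shows "\<exists>k s G. 0 < k \<and> s 0 = a \<and> s k = b \<and>
    (\<forall>i<k. unit_arc F (G i) (s i) (s (Suc i)) \<and> (\<forall>t\<in>{s i..s (Suc i)}. \<gamma> t = G i t))"
proof -
  have reg: "regular_piecewise_smooth \<gamma> a b"
    and unit: "\<And>t. t \<in> {a..b} \<Longrightarrow> \<gamma> differentiable (at t within {a..b}) \<Longrightarrow>
        F t (\<gamma> t) (vector_derivative \<gamma> (at t within {a..b})) = 1"
    using assms(2) unfolding trajectory_def by auto
  have "a < b" by (rule regular_piecewise_smooth_less[OF reg])
  obtain k s where s: "0 < k" "s 0 = a" "s k = b" "\<And>i. i < k \<Longrightarrow> s i < s (Suc i)"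
    and pieces: "\<And>i. i < k \<Longrightarrow> \<exists>U g. open U \<and> {s i..s (Suc i)} \<subseteq> U \<and> smooth_on g U \<and>
           (\<forall>t\<in>{s i..s (Suc i)}. \<gamma> t = g t \<and> vector_derivative g (at t) \<noteq> 0)"
    using reg unfolding regular_piecewise_smooth_def by blast
  have "\<exists>g. unit_arc F g (s i) (s (Suc i)) \<and> (\<forall>t\<in>{s i..s (Suc i)}. \<gamma> t = g t)" if i: "i < k" for i
  proof -
    obtain U g where U: "open U" "{s i..s (Suc i)} \<subseteq> U" "smooth_on g U"
      and g: "\<And>t. t \<in> {s i..s (Suc i)} \<Longrightarrow> \<gamma> t = g t \<and> vector_derivative g (at t) \<noteq> 0"
      using pieces[OF i] by blast
    let ?u = "\<lambda>t. F t (g t) (vector_derivative g (at t))"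
    have ab: "a \<le> s i" "s (Suc i) \<le> b"
      using partition_mono[of k s 0 i] partition_mono[of k s "Suc i" k] s i by auto
    have inner: "?u t = 1" if t: "t \<in> {s i<..<s (Suc i)}" for t
    proof -
      have "(g has_vector_derivative vector_derivative g (at t)) (at t)"
        using smooth_on_has_vector_derivative[OF U(3), of t] subsetD[OF U(2), of t] t by auto
      then have d: "(\<gamma> has_vector_derivative vector_derivative g (at t)) (at t)"
        by (rule has_vector_derivative_transform_within_open[OF _ open_greaterThanLessThan t]) (use g in auto)
      have "t \<in> {a..b}" using t ab by auto
      have d': "(\<gamma> has_vector_derivative vector_derivative g (at t)) (at t within {a..b})"
        by (rule has_vector_derivative_at_within[OF d])
      then have "\<gamma> differentiable (at t within {a..b})" by (rule differentiableI_vector)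
      from unit[OF \<open>t \<in> {a..b}\<close> this] show ?thesis
        using vector_derivative_within_ivl[OF d' \<open>t \<in> {a..b}\<close> \<open>a < b\<close>] g[of t] t by simp
    qed
    have cont: "continuous_on (closure {s i<..<s (Suc i)}) ?u"
    proof (rule finsler_continuous_on_compose[OF F])
      show "continuous_on (closure {s i<..<s (Suc i)}) g"
        using continuous_on_subset[OF smooth_on_continuous_on[OF U(3)] U(2)] s(4)[OF i] by simp
      show "continuous_on (closure {s i<..<s (Suc i)}) (\<lambda>t. vector_derivative g (at t))"
        using continuous_on_subset[OF smooth_on_continuous_on[OF smooth_on_vector_derivative[OF U(1,3)]] U(2)]
          s(4)[OF i] by simp
    qed (rule continuous_on_id)
    have "?u t = 1" if "t \<in> {s i..s (Suc i)}" for t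
      by (rule continuous_constant_on_closure[OF cont inner]) (use that s(4)[OF i] in auto)
    then show ?thesis unfolding unit_arc_def using U g s(4)[OF i] by blast
  qed
  then have "\<exists>G. \<forall>i<k. unit_arc F (G i) (s i) (s (Suc i)) \<and> (\<forall>t\<in>{s i..s (Suc i)}. \<gamma> t = G i t)"
    by metis
  then show ?thesis using s(1-3) by blast
qed

lemma arcs_unit_chain:
  assumes "\<And>i. i < k \<Longrightarrow> unit_arc F (G i) (s i) (s (Suc i)) \<and> (\<forall>t\<in>{s i..s (Suc i)}. \<gamma> t = G i t)"
    and "i \<le> j" "j \<le> k"
  shows "(unit_step F)\<^sup>*\<^sup>* (s i, \<gamma> (s i)) (s j, \<gamma> (s j))"
  using assms(2,3)
proof (induction j rule: dec_induct)
  case (step n)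
  have "unit_step F (s n, \<gamma> (s n)) (s (Suc n), \<gamma> (s (Suc n)))"
    unfolding unit_step_def using assms(1)[of n] step.prems step.hyps
    by (intro exI[of _ "G n"]) (auto simp: unit_arc_def)
  then show ?case using step by (meson Suc_leD rtranclp.rtrancl_into_rtrancl)
qed simp

text \<open>Only the arc adjoining the tack will be deformed, so the preceding ones are kept merely
  as a chain, which is empty when there is a single arc.\<close>

lemma trajectory_last_arc:
  assumes "time_dependent_finsler F" "trajectory F \<gamma> a b"
  obtains r g where "a \<le> r" "(unit_step F)\<^sup>*\<^sup>* (a, \<gamma> a) (r, \<gamma> r)" "unit_arc F g r b"
    "\<forall>t\<in>{r..b}. \<gamma> t = g t"
proof -
  obtain k s G where s: "0 < k" "s 0 = a" "s k = b"
    and G: "\<And>i. i < k \<Longrightarrow> unit_arc F (G i) (s i) (s (Suc i)) \<and> (\<forall>t\<in>{s i..s (Suc i)}. \<gamma> t = G i t)"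
    using trajectory_arcs[OF assms] by blast
  have "s 0 \<le> s (k - 1)"
    by (rule partition_mono[of k]) (use G in \<open>auto simp: unit_arc_def\<close>)
  moreover have "(unit_step F)\<^sup>*\<^sup>* (s 0, \<gamma> (s 0)) (s (k - 1), \<gamma> (s (k - 1)))"
    by (rule arcs_unit_chain[where F=F and G=G and s=s and \<gamma>=\<gamma>, OF G]) auto
  ultimately show ?thesis using that[of "s (k - 1)" "G (k - 1)"] G[of "k - 1"] s by auto
qed

lemma trajectory_first_arc:
  assumes "time_dependent_finsler F" "trajectory F \<gamma> a b"
  obtains r g where "unit_arc F g a r" "r \<le> b" "(unit_step F)\<^sup>*\<^sup>* (r, \<gamma> r) (b, \<gamma> b)"
    "\<forall>t\<in>{a..r}. \<gamma> t = g t"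
proof -
  obtain k s G where s: "0 < k" "s 0 = a" "s k = b"
    and G: "\<And>i. i < k \<Longrightarrow> unit_arc F (G i) (s i) (s (Suc i)) \<and> (\<forall>t\<in>{s i..s (Suc i)}. \<gamma> t = G i t)"
    using trajectory_arcs[OF assms] by blast
  have "s (Suc 0) \<le> s k"
    by (rule partition_mono[of k]) (use G s in \<open>auto simp: unit_arc_def\<close>)
  moreover have "(unit_step F)\<^sup>*\<^sup>* (s (Suc 0), \<gamma> (s (Suc 0))) (s k, \<gamma> (s k))"
    by (rule arcs_unit_chain[where F=F and G=G and s=s and \<gamma>=\<gamma>, OF G]) (use s in auto)
  ultimately show ?thesis using that[of "G 0" "s (Suc 0)"] G[of 0] s by auto
qed

section \<open>Gluing arcs back into trajectories\<close>

lemma unit_arc_trajectory: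
  assumes "unit_arc F g a b" shows "trajectory F g a b"
proof -
  obtain U where U: "open U" "{a..b} \<subseteq> U" "smooth_on g U" "a < b"
    and g: "\<And>t. t \<in> {a..b} \<Longrightarrow> vector_derivative g (at t) \<noteq> 0 \<and> F t (g t) (vector_derivative g (at t)) = 1"
    using assms unfolding unit_arc_def by blast
  have "\<exists>U h. open U \<and> {a..b} \<subseteq> U \<and> smooth_on h U \<and>
      (\<forall>t\<in>{a..b}. g t = h t \<and> vector_derivative h (at t) \<noteq> 0)"
    using U g by blast
  then have "regular_piecewise_smooth g a b"
    unfolding regular_piecewise_smooth_def
    by (intro exI[of _ 1] exI[of _ "\<lambda>i. if i = 0 then a else b"] )
      (simp add: U(4))
  moreover have "vector_derivative g (at t within {a..b}) = vector_derivative g (at t)" if "t \<in> {a..b}" for t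
    using has_vector_derivative_at_within[OF unit_arc_has_vector_derivative[OF assms that]] that U(4)
    by (rule vector_derivative_within_ivl)
  ultimately show ?thesis unfolding trajectory_def using g by simp
qed

lemma trajectory_append_unit_arc:
  assumes \<gamma>: "trajectory F \<gamma> a b" and g: "unit_arc F g b c" and "g b = \<gamma> b"
  shows "trajectory F (\<lambda>t. if t \<le> b then \<gamma> t else g t) a c" (is "trajectory F ?\<delta> a c")
proof -
  have reg: "regular_piecewise_smooth \<gamma> a b"
    and unit: "\<And>t. t \<in> {a..b} \<Longrightarrow> \<gamma> differentiable (at t within {a..b}) \<Longrightarrow>
        F t (\<gamma> t) (vector_derivative \<gamma> (at t within {a..b})) = 1"
    using \<gamma> unfolding trajectory_def by auto
  have "a < b" by (rule regular_piecewise_smooth_less[OF reg])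
  have "b < c" using g by (simp add: unit_arc_def)
  have \<delta>g: "?\<delta> t = g t" if "b \<le> t" for t using that assms(3) by auto
  obtain k s where s: "0 < k" "s 0 = a" "s k = b" "\<And>i. i < k \<Longrightarrow> s i < s (Suc i)"
    and pieces: "\<And>i. i < k \<Longrightarrow> \<exists>U g. open U \<and> {s i..s (Suc i)} \<subseteq> U \<and> smooth_on g U \<and>
           (\<forall>t\<in>{s i..s (Suc i)}. \<gamma> t = g t \<and> vector_derivative g (at t) \<noteq> 0)"
    using reg unfolding regular_piecewise_smooth_def by blast
  define s' where "s' = s(Suc k := c)"
  have "\<exists>U h. open U \<and> {s' i..s' (Suc i)} \<subseteq> U \<and> smooth_on h U \<and>
           (\<forall>t\<in>{s' i..s' (Suc i)}. ?\<delta> t = h t \<and> vector_derivative h (at t) \<noteq> 0)" if "i < Suc k" for i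
  proof (cases "i < k")
    case True
    then have eq: "s' i = s i" "s' (Suc i) = s (Suc i)" by (auto simp: s'_def)
    have "s (Suc i) \<le> b" using partition_mono[of k s "Suc i" k] s True by simp
    then show ?thesis using pieces[OF True] unfolding eq by auto
  next
    case False
    then have eq: "s' i = b" "s' (Suc i) = c" using that s(3) by (auto simp: s'_def less_Suc_eq)
    obtain U where U: "open U" "{b..c} \<subseteq> U" "smooth_on g U" using g unfolding unit_arc_def by blast
    show ?thesis unfolding eq
      by (rule exI[of _ U], rule exI[of _ g]) (use U g \<delta>g assms(3) in \<open>auto simp: unit_arc_def\<close>)
  qed
  moreover have "s' i < s' (Suc i)" if "i < Suc k" for i
    using that s \<open>b < c\<close> by (auto simp: s'_def less_Suc_eq)
  ultimately have "regular_piecewise_smooth ?\<delta> a c"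
    unfolding regular_piecewise_smooth_def
    by (intro exI[of _ "Suc k"] exI[of _ s']) (use s in \<open>auto simp: s'_def\<close>)
  moreover have "F t (?\<delta> t) (vector_derivative ?\<delta> (at t within {a..c})) = 1"
    if t: "t \<in> {a..c}" and diff: "?\<delta> differentiable (at t within {a..c})" for t
  proof -
    define D where "D = vector_derivative ?\<delta> (at t within {a..c})"
    have D: "(?\<delta> has_vector_derivative D) (at t within {a..c})"
      using diff unfolding D_def by (simp add: vector_derivative_works)
    show ?thesis
    proof (cases "t \<le> b")
      \<comment> \<open>The corner \<open>t = b\<close> falls under this case: if the glued curve
        happens to be differentiable there, its derivative is the one of \<open>\<gamma>\<close>
        within \<open>{a..b}\<close>, which is already known to be unit.\<close>
      case True
      then have tab: "t \<in> {a..b}" using t by auto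
      have "(?\<delta> has_vector_derivative D) (at t within {a..b})"
        by (rule has_vector_derivative_within_subset[OF D]) (use \<open>b < c\<close> in auto)
      then have d: "(\<gamma> has_vector_derivative D) (at t within {a..b})"
        by (rule has_vector_derivative_transform[rotated 2]) (use tab in auto)
      show ?thesis
        using unit[OF tab differentiableI_vector[OF d]] vector_derivative_within_ivl[OF d tab \<open>a < b\<close>] True
        by (simp add: D_def)
    next
      case False
      then have tbc: "t \<in> {b..c}" using t by auto
      have "(?\<delta> has_vector_derivative D) (at t within {b..c})"
        by (rule has_vector_derivative_within_subset[OF D]) (use \<open>a < b\<close> in auto)
      then have "(g has_vector_derivative D) (at t within {b..c})"
        by (rule has_vector_derivative_transform[rotated 2]) (use tbc assms(3) in auto)
      moreover have "(g has_vector_derivative vector_derivative g (at t)) (at t within {b..c})"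
        by (rule has_vector_derivative_at_within[OF unit_arc_has_vector_derivative[OF g tbc]])
      ultimately have "D = vector_derivative g (at t)"
        using vector_derivative_within_ivl tbc \<open>b < c\<close> by metis
      then show ?thesis using g tbc False by (simp add: unit_arc_def D_def)
    qed
  qed
  ultimately show ?thesis unfolding trajectory_def by blast
qed

text \<open>At least one step is required because a trajectory has a nondegenerate parameter
  interval.\<close>

lemma unit_chain_trajectory:
  assumes "(unit_step F)\<^sup>+\<^sup>+ P Q"
  shows "\<exists>\<gamma>. trajectory F \<gamma> (fst P) (fst Q) \<and> \<gamma> (fst P) = snd P \<and> \<gamma> (fst Q) = snd Q"
  using assms
proof (induction rule: tranclp_induct)
  case (base Q)
  then show ?case unfolding unit_step_def using unit_arc_trajectory by blast
next
  case (step Q R)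
  then obtain \<gamma> where \<gamma>: "trajectory F \<gamma> (fst P) (fst Q)" "\<gamma> (fst P) = snd P" "\<gamma> (fst Q) = snd Q" by blast
  obtain g where g: "unit_arc F g (fst Q) (fst R)" "g (fst Q) = snd Q" "g (fst R) = snd R"
    using step.hyps(2) unfolding unit_step_def by blast
  have "fst P < fst Q" using \<gamma>(1) regular_piecewise_smooth_less unfolding trajectory_def by blast
  moreover have "fst Q < fst R" using g(1) by (simp add: unit_arc_def)
  ultimately show ?case
    using trajectory_append_unit_arc[OF \<gamma>(1) g(1)] g \<gamma>
    by (intro exI[of _ "\<lambda>t. if t \<le> fst Q then \<gamma> t else g t"]) auto
qed


section \<open>First variation of the arrival time\<close>

text \<open>The fibre derivative of \<open>F\<close> at \<open>v\<close>, paired with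
  \<open>u\<close>. It is taken as a component of the full derivative in time, point and velocity
  because dragging an arc changes all three together.\<close>

definition momentum ::
    "(real \<Rightarrow> real ^ 'n \<Rightarrow> real ^ 'n \<Rightarrow> real) \<Rightarrow> real \<Rightarrow> real ^ 'n \<Rightarrow> real ^ 'n \<Rightarrow> real ^ 'n \<Rightarrow> real" where
  "momentum F t x v u = frechet_derivative (\<lambda>(t, x, v). F t x v) (at (t, x, v)) (0, 0, u)"

lemma linear_finsler_derivative:
  assumes "time_dependent_finsler F" "v \<noteq> 0"
  shows "linear (frechet_derivative (\<lambda>(t, x, v). F t x v) (at (t, x, v)))"
  using finsler_has_derivative[OF assms] has_derivative_linear by blast

lemma linear_momentum:
  assumes "time_dependent_finsler F" "v \<noteq> 0"
  shows "linear (momentum F t x v)"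
  using linear_compose[OF _ linear_finsler_derivative[OF assms, of t x], of "\<lambda>u. (0, 0, u)"]
  by (simp add: momentum_def[abs_def] o_def linear_iff)

lemma partial_deriv_finsler:
  assumes "time_dependent_finsler F" "v \<noteq> 0"
  shows "partial_deriv i (F t x) v = momentum F t x v (axis i 1)"
proof -
  let ?\<Phi> = "\<lambda>(t, x, v). F t x v"
  let ?D = "frechet_derivative ?\<Phi> (at (t, x, v))"
  have "((\<lambda>s::real. (t, x, v + s *\<^sub>R axis i 1)) has_derivative (\<lambda>s. (0, 0, s *\<^sub>R axis i 1))) (at 0)"
    by (auto intro!: derivative_eq_intros)
  moreover have "(?\<Phi> has_derivative ?D) (at (t, x, v + 0 *\<^sub>R axis i 1))"
    using finsler_has_derivative[OF assms] by simp
  ultimately have "((\<lambda>s. F t x (v + s *\<^sub>R axis i 1)) has_derivative (\<lambda>s. ?D (0, 0, s *\<^sub>R axis i 1))) (at 0)"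
    using diff_chain_at[of "\<lambda>s::real. (t, x, v + s *\<^sub>R axis i 1)" "\<lambda>s. (0, 0, s *\<^sub>R axis i 1)" 0 ?\<Phi> ?D]
    by (simp add: o_def)
  moreover have "?D (0, 0, s *\<^sub>R axis i 1) = momentum F t x v (axis i 1) * s" for s
    using linear_scale[OF linear_momentum[OF assms, of t x], of s "axis i 1"] by (simp add: momentum_def)
  ultimately have "((\<lambda>s. F t x (v + s *\<^sub>R axis i 1)) has_field_derivative momentum F t x v (axis i 1)) (at 0)"
    by (simp add: has_field_derivative_def)
  then show ?thesis unfolding partial_deriv_def by (rule DERIV_imp_deriv)
qed

lemma sum_partial_deriv_finsler:
  assumes "time_dependent_finsler F" "v \<noteq> 0"
  shows "(\<Sum>i\<in>UNIV. partial_deriv i (F t x) v * u $ i) = momentum F t x v u"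
proof -
  have "momentum F t x v u = momentum F t x v (\<Sum>i\<in>UNIV. u $ i *\<^sub>R axis i 1)"
    using basis_expansion[of u] by (simp add: scalar_mult_eq_scaleR)
  also have "\<dots> = (\<Sum>i\<in>UNIV. u $ i * momentum F t x v (axis i 1))"
    by (simp add: linear_sum[OF linear_momentum[OF assms]] linear_scale[OF linear_momentum[OF assms]])
  finally show ?thesis by (simp add: partial_deriv_finsler[OF assms] mult.commute)
qed

text \<open>\<open>E\<close> is the derivative of the varied speed with respect to
  \<open>\<rho>\<close>. Time and point are shifted by \<open>\<rho> * h\<close> and
  \<open>(\<rho> * k) *\<^sub>R u\<close>, so for \<open>h = k = 0\<close> only the velocity term
  survives, and at \<open>(t0, 0, 0, 0)\<close> \<open>E\<close> equals the momentum. By continuity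
  \<open>E < m\<close> near that point, and the mean value theorem in \<open>\<rho>\<close> turns
  this into a bound uniform in the other parameters.\<close>

lemma finsler_varied_speed:
  fixes F :: "real \<Rightarrow> real ^ 'n \<Rightarrow> real ^ 'n \<Rightarrow> real"
  assumes F: "time_dependent_finsler F" and "open U" and x: "continuous_on U x" and v: "continuous_on U v"
    and "t0 \<in> U" "v t0 \<noteq> 0" and m: "momentum F t0 (x t0) (v t0) u < m"
  shows "\<exists>e>0. \<forall>s \<rho> h k. \<bar>s - t0\<bar> < e \<longrightarrow> 0 < \<rho> \<longrightarrow> \<rho> < e \<longrightarrow> \<bar>h\<bar> < e \<longrightarrow> \<bar>k\<bar> < e \<longrightarrow>
    v s + \<rho> *\<^sub>R u \<noteq> 0 \<and>
    F (s + \<rho> * h) (x s + (\<rho> * k) *\<^sub>R u) (v s + \<rho> *\<^sub>R u) < F s (x s) (v s) + \<rho> * m"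
proof -
  let ?\<Phi> = "\<lambda>(t, x, v). F t x v"
  define \<omega> where "\<omega> z = (case z of (s, \<rho>, h, k) \<Rightarrow>
    (s + \<rho> * h, x s + (\<rho> * k) *\<^sub>R u, v s + \<rho> *\<^sub>R u))" for z :: "real \<times> real \<times> real \<times> real"
  define D where "D z = frechet_derivative ?\<Phi> (at (\<omega> z))" for z
  define E where "E z = fst (snd (snd z)) * D z (1, 0, 0) + snd (snd (snd z)) * D z (0, u, 0) + D z (0, 0, u)"
    for z
  let ?W = "U \<times> (UNIV :: (real \<times> real \<times> real) set)"
  let ?Z = "{(t::real, x::real ^ 'n, v::real ^ 'n). v \<noteq> 0}"
  have oW: "open ?W" using \<open>open U\<close> by (simp add: open_Times)
  have c\<omega>: "continuous_on ?W \<omega>"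
    unfolding \<omega>_def case_prod_beta
    by (intro continuous_intros continuous_on_compose2[OF x] continuous_on_compose2[OF v]) auto
  define V where "V = ?W \<inter> \<omega> -` ?Z"
  have oV: "open V"
    unfolding V_def by (rule continuous_open_preimage[OF c\<omega> oW open_nonzero_velocity])
  have cD: "continuous_on V (\<lambda>z. D z h)" for h
    unfolding D_def
    by (rule continuous_on_compose2[OF smooth_on_continuous_on[OF smooth_on_frechet_derivative[OF finsler_smooth[OF F]]]
          continuous_on_subset[OF c\<omega>]]) (auto simp: V_def)
  have "continuous_on V E"
    unfolding E_def by (intro continuous_intros cD)
  then have "open (V \<inter> E -` {..<m})" by (rule continuous_open_preimage[OF _ oV open_lessThan])
  moreover have "(t0, 0, 0, 0) \<in> V \<inter> E -` {..<m}"
    using assms(5,6) m by (simp add: V_def \<omega>_def E_def D_def momentum_def)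
  ultimately obtain e where e: "e > 0" "ball (t0, 0, 0, 0) e \<subseteq> V \<inter> E -` {..<m}"
    by (meson openE)
  \<comment> \<open>The norm of a quadruple is at most the sum of its four entries, whence the
    quarter of \<open>e\<close>.\<close>
  have near: "(s, \<rho>, h, k) \<in> V \<and> E (s, \<rho>, h, k) < m"
    if "\<bar>s - t0\<bar> < e / 4" "\<bar>\<rho>\<bar> < e / 4" "\<bar>h\<bar> < e / 4" "\<bar>k\<bar> < e / 4" for s \<rho> h k
  proof -
    have "norm (s - t0, \<rho>, h, k) \<le> \<bar>s - t0\<bar> + (\<bar>\<rho>\<bar> + (\<bar>h\<bar> + \<bar>k\<bar>))"
      using norm_Pair_le[of "s - t0" "(\<rho>, h, k)"] norm_Pair_le[of \<rho> "(h, k)"] norm_Pair_le[of h k] by simp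
    also have "\<dots> < e" using that by linarith
    finally have "(s, \<rho>, h, k) \<in> ball (t0, 0, 0, 0) e"
      unfolding mem_ball dist_commute[of "(t0, 0, 0, 0)"] by (simp add: dist_norm)
    then show ?thesis using e(2) by blast
  qed
  have "v s + \<rho> *\<^sub>R u \<noteq> 0 \<and>
      F (s + \<rho> * h) (x s + (\<rho> * k) *\<^sub>R u) (v s + \<rho> *\<^sub>R u) < F s (x s) (v s) + \<rho> * m"
    if "\<bar>s - t0\<bar> < e / 4" "0 < \<rho>" "\<rho> < e / 4" "\<bar>h\<bar> < e / 4" "\<bar>k\<bar> < e / 4" for s \<rho> h k
  proof
    have nr: "(s, r, h, k) \<in> V" "E (s, r, h, k) < m" if "0 \<le> r" "r \<le> \<rho>" for r
      using near[of s r h k] that \<open>\<bar>s - t0\<bar> < e / 4\<close> \<open>\<rho> < e / 4\<close> \<open>\<bar>h\<bar> < e / 4\<close> \<open>\<bar>k\<bar> < e / 4\<close> by auto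
    show "v s + \<rho> *\<^sub>R u \<noteq> 0" using nr(1)[of \<rho>] that(2) by (simp add: V_def \<omega>_def)
    define \<phi> where "\<phi> r = F (s + r * h) (x s + (r * k) *\<^sub>R u) (v s + r *\<^sub>R u)" for r
    have "(\<phi> has_real_derivative E (s, r, h, k)) (at r)" if "0 \<le> r" "r \<le> \<rho>" for r
    proof -
      let ?c = "\<lambda>r. \<omega> (s, r, h, k)"
      have nz: "v s + r *\<^sub>R u \<noteq> 0" using nr(1)[OF that] by (simp add: V_def \<omega>_def)
      have "(?c has_derivative (\<lambda>d. (d * h, (d * k) *\<^sub>R u, d *\<^sub>R u))) (at r)"
        unfolding \<omega>_def by (auto intro!: derivative_eq_intros)
      moreover have "(?\<Phi> has_derivative D (s, r, h, k)) (at (?c r))"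
        using finsler_has_derivative[OF F nz] by (simp add: D_def \<omega>_def)
      ultimately have "(\<phi> has_derivative (\<lambda>d. D (s, r, h, k) (d * h, (d * k) *\<^sub>R u, d *\<^sub>R u))) (at r)"
        using diff_chain_at[of ?c "\<lambda>d. (d * h, (d * k) *\<^sub>R u, d *\<^sub>R u)" r ?\<Phi> "D (s, r, h, k)"]
        by (simp add: o_def \<omega>_def \<phi>_def[abs_def])
      moreover have "D (s, r, h, k) (d * h, (d * k) *\<^sub>R u, d *\<^sub>R u) = E (s, r, h, k) * d" for d
      proof -
        have lin: "linear (D (s, r, h, k))"
          using linear_finsler_derivative[OF F nz] by (simp add: D_def \<omega>_def)
        have "(d * h, (d * k) *\<^sub>R u, d *\<^sub>R u) =
            (d * h) *\<^sub>R (1, 0, 0) + ((d * k) *\<^sub>R (0, u, 0) + d *\<^sub>R (0, 0, u))" by simp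
        then show ?thesis
          by (simp only: linear_add[OF lin] linear_scale[OF lin]) (simp add: E_def algebra_simps)
      qed
      ultimately show ?thesis by (simp add: has_field_derivative_def)
    qed
    then obtain z where "z > 0" "z < \<rho>" "\<phi> \<rho> - \<phi> 0 = (\<rho> - 0) * E (s, z, h, k)"
      using MVT2[OF \<open>0 < \<rho>\<close>, of \<phi> "\<lambda>r. E (s, r, h, k)"] by blast
    moreover from this have "\<rho> * E (s, z, h, k) < \<rho> * m"
      using mult_strict_left_mono[OF nr(2)[of z] that(2)] by linarith
    ultimately have "\<phi> \<rho> < \<phi> 0 + \<rho> * m" unfolding diff_0_right by linarith
    then show "F (s + \<rho> * h) (x s + (\<rho> * k) *\<^sub>R u) (v s + \<rho> *\<^sub>R u) < F s (x s) (v s) + \<rho> * m"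
      by (simp add: \<phi>_def)
  qed
  then show ?thesis using e(1) by (intro exI[of _ "e / 4"]) auto
qed

text \<open>Dragging the points of an arc by \<open>\<rho> (s - r)\<close> in direction \<open>u\<close> delays the clock by about
  \<open>\<rho> (s - r)\<close> times the momentum in direction \<open>u\<close>.\<close>

lemma unit_arc_variation:
  fixes F :: "real \<Rightarrow> real ^ 'n \<Rightarrow> real ^ 'n \<Rightarrow> real"
  assumes F: "time_dependent_finsler F" and bounds: "finsler_bounds F" and g: "unit_arc F g a b"
    and t0: "t0 \<in> {a..b}" and m: "momentum F t0 (g t0) (vector_derivative g (at t0)) u < m"
  shows "\<exists>e>0. \<forall>x y r h \<rho> ta. a \<le> x \<longrightarrow> x < y \<longrightarrow> y \<le> b \<longrightarrow> \<bar>x - t0\<bar> < e \<longrightarrow> \<bar>y - t0\<bar> < e \<longrightarrow>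
    \<bar>r - t0\<bar> < e \<longrightarrow> \<bar>h\<bar> < e \<longrightarrow> 0 < \<rho> \<longrightarrow> \<rho> < e \<longrightarrow> ta < x + \<rho> * (m * (x - r) + h) \<longrightarrow>
    (\<exists>tb f. tb < y + \<rho> * (m * (y - r) + h) \<and> unit_arc F f ta tb \<and>
       f ta = g x + (\<rho> * (x - r)) *\<^sub>R u \<and> f tb = g y + (\<rho> * (y - r)) *\<^sub>R u)"
proof -
  obtain U where U: "open U" "{a..b} \<subseteq> U" "smooth_on g U"
    and unit: "\<And>t. t \<in> {a..b} \<Longrightarrow> vector_derivative g (at t) \<noteq> 0 \<and> F t (g t) (vector_derivative g (at t)) = 1"
    using g unfolding unit_arc_def by blast
  have "t0 \<in> U" using t0 U(2) by blast
  obtain e where "e > 0" and e: "\<And>s \<rho> h k. \<bar>s - t0\<bar> < e \<Longrightarrow> 0 < \<rho> \<Longrightarrow> \<rho> < e \<Longrightarrow> \<bar>h\<bar> < e \<Longrightarrow> \<bar>k\<bar> < e \<Longrightarrow>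
      vector_derivative g (at s) + \<rho> *\<^sub>R u \<noteq> 0 \<and>
      F (s + \<rho> * h) (g s + (\<rho> * k) *\<^sub>R u) (vector_derivative g (at s) + \<rho> *\<^sub>R u)
        < F s (g s) (vector_derivative g (at s)) + \<rho> * m"
    using finsler_varied_speed[OF F U(1) smooth_on_continuous_on[OF U(3)]
        smooth_on_continuous_on[OF smooth_on_vector_derivative[OF U(1,3)]] \<open>t0 \<in> U\<close> conjunct1[OF unit[OF t0]] m]
    by blast
  \<comment> \<open>Chosen so that \<open>\<bar>s - r\<bar> < 2 * e'\<close> and
    \<open>\<bar>h\<bar> < e'\<close> force the time shift coefficient
    \<open>m * (s - r) + h\<close> below \<open>e\<close> in absolute value.\<close>
  define e' where "e' = e / (2 * \<bar>m\<bar> + 2)"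
  have e'0: "e' > 0" using \<open>e > 0\<close> by (simp add: e'_def)
  have ee': "(2 * \<bar>m\<bar> + 2) * e' = e" by (simp add: e'_def)
  have e'le: "2 * e' \<le> e" 
  proof -
    have "0 \<le> 2 * \<bar>m\<bar> * e'" using e'0 by simp
    then show ?thesis using ee' unfolding distrib_right by linarith
  qed
  have res: "\<exists>tb f. tb < y + \<rho> * (m * (y - r) + h) \<and> unit_arc F f ta tb \<and>
       f ta = g x + (\<rho> * (x - r)) *\<^sub>R u \<and> f tb = g y + (\<rho> * (y - r)) *\<^sub>R u"
    if "a \<le> x" "x < y" "y \<le> b" "\<bar>x - t0\<bar> < e'" "\<bar>y - t0\<bar> < e'" "\<bar>r - t0\<bar> < e'" "\<bar>h\<bar> < e'"
      "0 < \<rho>" "\<rho> < e'" "ta < x + \<rho> * (m * (x - r) + h)" for x y r h \<rho> ta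
  proof -
    \<comment> \<open>The point at parameter \<open>r\<close> is left fixed, and every velocity
      changes by the same vector \<open>\<rho> *\<^sub>R u\<close>.\<close>
    define c where "c = (\<lambda>s. g s + (\<rho> * s + - \<rho> * r) *\<^sub>R u)"
    have "smooth_on c U"
      unfolding smooth_on_def c_def
      by (intro allI Ck_on_add[OF U(1)] Ck_on_scaleR[OF U(1)] Ck_on_const smooth_on_imp_Ck[OF U(3)]
          Ck_on_bounded_linear[OF U(1) bounded_linear_mult_right])
    have c': "vector_derivative c (at s) = vector_derivative g (at s) + \<rho> *\<^sub>R u" if "s \<in> U" for s
    proof (rule vector_derivative_at)
      have "((\<lambda>s. (\<rho> * s + - \<rho> * r) *\<^sub>R u) has_vector_derivative \<rho> *\<^sub>R u) (at s)"
        by (auto intro!: derivative_eq_intros simp: has_vector_derivative_def)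
      then show "(c has_vector_derivative vector_derivative g (at s) + \<rho> *\<^sub>R u) (at s)"
        unfolding c_def by (rule has_vector_derivative_add[OF smooth_on_has_vector_derivative[OF U(3) that]])
    qed
    \<comment> \<open>The reference clock \<open>s + \<rho> * (m * (s - r) + h)\<close> in affine
      form. Its rate \<open>1 + \<rho> * m\<close> dominates the varied speed because the
      undisturbed speed is 1.\<close>
    define l where "l = 1 + \<rho> * m"
    define d where "d = \<rho> * (h - m * r)"
    have clock: "l * s + d = s + \<rho> * (m * (s - r) + h)" for s
      by (simp add: l_def d_def algebra_simps)
    have xyU: "{x..y} \<subseteq> U" using that U(2) by force
    have main: "vector_derivative c (at s) \<noteq> 0 \<and> F (l * s + d) (c s) (vector_derivative c (at s)) \<le> l"
      if s: "s \<in> {x..y}" for s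
    proof -
      have st: "\<bar>s - t0\<bar> < e'" using s \<open>\<bar>x - t0\<bar> < e'\<close> \<open>\<bar>y - t0\<bar> < e'\<close> by auto
      have sr: "\<bar>s - r\<bar> < 2 * e'" using st \<open>\<bar>r - t0\<bar> < e'\<close> by linarith
      have "\<bar>m * (s - r) + h\<bar> \<le> \<bar>m\<bar> * \<bar>s - r\<bar> + \<bar>h\<bar>" by (metis abs_mult abs_triangle_ineq)
      also have "\<dots> < \<bar>m\<bar> * (2 * e') + 2 * e'"
        using sr \<open>\<bar>h\<bar> < e'\<close> mult_left_mono[of "\<bar>s - r\<bar>" "2 * e'" "\<bar>m\<bar>"] by linarith
      also have "\<dots> = e" using ee' by (simp add: algebra_simps)
      finally have "vector_derivative g (at s) + \<rho> *\<^sub>R u \<noteq> 0 \<and>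
          F (s + \<rho> * (m * (s - r) + h)) (g s + (\<rho> * (s - r)) *\<^sub>R u) (vector_derivative g (at s) + \<rho> *\<^sub>R u)
          < F s (g s) (vector_derivative g (at s)) + \<rho> * m"
        using st sr \<open>\<rho> < e'\<close> \<open>0 < \<rho>\<close> e'le e'0 by (intro e) auto
      moreover have "s \<in> {a..b}" using s \<open>a \<le> x\<close> \<open>y \<le> b\<close> by auto
      moreover have "c s = g s + (\<rho> * (s - r)) *\<^sub>R u" by (simp add: c_def algebra_simps)
      ultimately show ?thesis
        using unit[of s] c'[of s] xyU s unfolding clock by (auto simp: l_def)
    qed
    have "\<exists>tb f. tb < l * y + d \<and> unit_arc F f ta tb \<and> f ta = c x \<and> f tb = c y"
      by (rule unit_arc_ahead_of_clock[OF F bounds \<open>x < y\<close> U(1) xyU \<open>smooth_on c U\<close>])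
        (use main that(10) in \<open>auto simp: clock\<close>)
    then show ?thesis by (simp add: clock c_def right_diff_distrib)
  qed
  show ?thesis
    by (rule exI[of _ e'], rule conjI[OF e'0], (rule allI | rule impI)+, rule res)
qed

section \<open>Competing tack points and the contradiction with optimality\<close>

lemma minimal_arrival_time_le:
  assumes "(unit_step F)\<^sup>+\<^sup>+ (s, x) (t, y)" "x \<in> P" "y \<in> Q"
  shows "minimal_arrival_time F s P Q \<le> t"
  unfolding minimal_arrival_time_def
proof (rule cInf_lower)
  show "t \<in> arrival_times F s P Q"
    using unit_chain_trajectory[OF assms(1)] assms(2,3) by (auto simp: arrival_times_def)
  show "bdd_below (arrival_times F s P Q)"
    by (rule bdd_belowI[of _ s])
      (auto simp: arrival_times_def trajectory_def dest!: regular_piecewise_smooth_less)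
qed

text \<open>Stated with the arcs adjoining the tack and the chains outside them, because these
  chains are not deformed: the first is reused as it stands, the second is followed again from an
  earlier departure.\<close>

lemma optimal_tack_momentum_le:
  fixes F\<alpha> F\<beta> :: "real \<Rightarrow> real ^ 'n \<Rightarrow> real ^ 'n \<Rightarrow> real"
  assumes \<alpha>: "time_dependent_finsler F\<alpha>" "finsler_bounds F\<alpha>"
    and \<beta>: "time_dependent_finsler F\<beta>" "finsler_bounds F\<beta>"
    and opt: "optimal_tack_point F\<alpha> F\<beta> A B p" and T: "T = total_time F\<alpha> F\<beta> A B p"
    and \<gamma>\<alpha>: "trajectory F\<alpha> \<gamma>\<alpha> 0 t0" "\<gamma>\<alpha> 0 \<in> A" "\<gamma>\<alpha> t0 = p"
    and \<gamma>\<beta>: "trajectory F\<beta> \<gamma>\<beta> t0 T" "\<gamma>\<beta> t0 = p" "\<gamma>\<beta> T \<in> B"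
    and g\<alpha>: "unit_arc F\<alpha> g\<alpha> r0 t0" "\<And>t. t \<in> {r0..t0} \<Longrightarrow> \<gamma>\<alpha> t = g\<alpha> t"
      "(unit_step F\<alpha>)\<^sup>*\<^sup>* (0, \<gamma>\<alpha> 0) (r0, \<gamma>\<alpha> r0)"
    and g\<beta>: "unit_arc F\<beta> g\<beta> t0 r1" "\<And>t. t \<in> {t0..r1} \<Longrightarrow> \<gamma>\<beta> t = g\<beta> t"
      "(unit_step F\<beta>)\<^sup>*\<^sup>* (r1, \<gamma>\<beta> r1) (T, \<gamma>\<beta> T)"
  shows "momentum F\<beta> t0 p (vector_derivative g\<beta> (at t0)) u \<le> momentum F\<alpha> t0 p (vector_derivative g\<alpha> (at t0)) u"
proof (rule ccontr)
  let ?a = "momentum F\<alpha> t0 p (vector_derivative g\<alpha> (at t0)) u"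
  let ?b = "momentum F\<beta> t0 p (vector_derivative g\<beta> (at t0)) u"
  assume "\<not> ?b \<le> ?a"
  \<comment> \<open>Separating the two momenta by \<open>a' < b'\<close> leaves room in both
    variation estimates and a positive gap between the two clocks at the tack.\<close>
  then obtain a' where "?a < a'" "a' < ?b" using dense[of ?a ?b] by auto
  then obtain b' where "a' < b'" "b' < ?b" using dense by blast
  have r: "r0 < t0" "t0 < r1" using g\<alpha>(1) g\<beta>(1) by (auto simp: unit_arc_def)
  have p\<alpha>: "g\<alpha> t0 = p" using g\<alpha>(2)[of t0] r \<gamma>\<alpha>(3) by simp
  have p\<beta>: "g\<beta> t0 = p" using g\<beta>(2)[of t0] r \<gamma>\<beta>(2) by simp
  obtain e1 where e1: "e1 > 0" and var1: "\<And>x y r h \<rho> ta. r0 \<le> x \<Longrightarrow> x < y \<Longrightarrow> y \<le> t0 \<Longrightarrow>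
      \<bar>x - t0\<bar> < e1 \<Longrightarrow> \<bar>y - t0\<bar> < e1 \<Longrightarrow> \<bar>r - t0\<bar> < e1 \<Longrightarrow> \<bar>h\<bar> < e1 \<Longrightarrow> 0 < \<rho> \<Longrightarrow> \<rho> < e1 \<Longrightarrow>
      ta < x + \<rho> * (a' * (x - r) + h) \<Longrightarrow>
      \<exists>tb f. tb < y + \<rho> * (a' * (y - r) + h) \<and> unit_arc F\<alpha> f ta tb \<and>
        f ta = g\<alpha> x + (\<rho> * (x - r)) *\<^sub>R u \<and> f tb = g\<alpha> y + (\<rho> * (y - r)) *\<^sub>R u"
    using unit_arc_variation[OF \<alpha> g\<alpha>(1), of t0 u a'] r \<open>?a < a'\<close> p\<alpha> by auto
  have nz\<beta>: "vector_derivative g\<beta> (at t0) \<noteq> 0" using g\<beta>(1) r by (simp add: unit_arc_def)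
  \<comment> \<open>The second leg is varied along \<open>- u\<close> with fixed point
    \<open>r = t0 + \<delta>\<close>: its displacement is
    \<open>(\<rho> * (t0 + \<delta> - s)) *\<^sub>R u\<close>, which starts at \<open>q\<close> and
    dies out at \<open>t0 + \<delta>\<close>.\<close>
  have "momentum F\<beta> t0 p (vector_derivative g\<beta> (at t0)) (- u) < - b'"
    using \<open>b' < ?b\<close> linear_neg[OF linear_momentum[OF \<beta>(1) nz\<beta>]] by simp
  then obtain e2 where e2: "e2 > 0" and var2: "\<And>x y r h \<rho> ta. t0 \<le> x \<Longrightarrow> x < y \<Longrightarrow> y \<le> r1 \<Longrightarrow>
      \<bar>x - t0\<bar> < e2 \<Longrightarrow> \<bar>y - t0\<bar> < e2 \<Longrightarrow> \<bar>r - t0\<bar> < e2 \<Longrightarrow> \<bar>h\<bar> < e2 \<Longrightarrow> 0 < \<rho> \<Longrightarrow> \<rho> < e2 \<Longrightarrow>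
      ta < x + \<rho> * (- b' * (x - r) + h) \<Longrightarrow>
      \<exists>tb f. tb < y + \<rho> * (- b' * (y - r) + h) \<and> unit_arc F\<beta> f ta tb \<and>
        f ta = g\<beta> x + (\<rho> * (x - r)) *\<^sub>R (- u) \<and> f tb = g\<beta> y + (\<rho> * (y - r)) *\<^sub>R (- u)"
    using unit_arc_variation[OF \<beta> g\<beta>(1), of t0 "- u" "- b'"] r p\<beta> by auto
  \<comment> \<open>The entry \<open>e1 / (b' - a')\<close> keeps the margin \<open>\<eta>\<close>
    below within the range \<open>e1\<close>; the last two keep the drag inside the two adjoining
    arcs.\<close>
  define \<delta> where "\<delta> = Min {e1, e2, e1 / (b' - a'), t0 - r0, r1 - t0} / 2"
  have "\<delta> > 0" unfolding \<delta>_def using e1 e2 r \<open>a' < b'\<close> by simp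
  have "2 * \<delta> \<le> e1" "2 * \<delta> \<le> e2" "2 * \<delta> \<le> e1 / (b' - a')" "2 * \<delta> \<le> t0 - r0" "2 * \<delta> \<le> r1 - t0"
    unfolding \<delta>_def by simp_all
  then have \<delta>: "\<delta> < e1" "\<delta> < e2" "\<delta> < t0 - r0" "\<delta> < r1 - t0" "\<delta> < e1 / (b' - a')"
    using \<open>\<delta> > 0\<close> by linarith+
  \<comment> \<open>The undisturbed arc reaches \<open>t0 - \<delta>\<close> exactly on time, but
    the variation estimate wants a strictly early departure. Setting the first clock ahead by
    \<open>\<rho> * \<eta>\<close> creates that lead; half of the gap is spent, so
    \<open>a' * \<delta> + \<eta>\<close> is the midpoint of \<open>a' * \<delta>\<close> and
    \<open>b' * \<delta>\<close>.\<close>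
  define \<eta> where "\<eta> = (b' - a') * \<delta> / 2"
  have \<eta>: "\<eta> > 0" "\<bar>\<eta>\<bar> < e1" "a' * \<delta> + \<eta> < b' * \<delta>"
  proof -
    show "\<eta> > 0" using \<open>\<delta> > 0\<close> \<open>a' < b'\<close> by (simp add: \<eta>_def)
    have "(b' - a') * \<delta> < e1" using \<delta>(5) \<open>a' < b'\<close> by (simp add: field_simps)
    then show "\<bar>\<eta>\<bar> < e1" using \<open>\<eta> > 0\<close> e1 unfolding \<eta>_def by linarith
    have "(b' - a') * \<delta> > 0" using \<open>\<delta> > 0\<close> \<open>a' < b'\<close> by simp
    then show "a' * \<delta> + \<eta> < b' * \<delta>" unfolding \<eta>_def left_diff_distrib by (simp add: field_simps)
  qed
  define \<rho> where "\<rho> = min e1 e2 / 2"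
  have \<rho>: "0 < \<rho>" "\<rho> < e1" "\<rho> < e2" using e1 e2 by (auto simp: \<rho>_def)
  define q where "q = p + (\<rho> * \<delta>) *\<^sub>R u"

  have "t0 - \<delta> < (t0 - \<delta>) + \<rho> * (a' * ((t0 - \<delta>) - (t0 - \<delta>)) + \<eta>)" using \<rho>(1) \<eta>(1) by simp
  from var1[OF _ _ _ _ _ _ \<eta>(2) \<rho>(1,2) this, of t0] obtain t1 f where
    t1: "t1 < t0 + \<rho> * (a' * \<delta> + \<eta>)" and f: "unit_arc F\<alpha> f (t0 - \<delta>) t1" "f (t0 - \<delta>) = g\<alpha> (t0 - \<delta>)" "f t1 = q"
    using \<delta> \<open>\<delta> > 0\<close> e1 by (auto simp: q_def p\<alpha>)
  have "unit_step F\<alpha> (r0, \<gamma>\<alpha> r0) (t0 - \<delta>, g\<alpha> (t0 - \<delta>))"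
    unfolding unit_step_def using unit_arc_subinterval[OF g\<alpha>(1), of r0 "t0 - \<delta>"] \<delta> \<open>\<delta> > 0\<close> r g\<alpha>(2)
    by (intro exI[of _ g\<alpha>]) auto
  moreover have "unit_step F\<alpha> (t0 - \<delta>, g\<alpha> (t0 - \<delta>)) (t1, q)"
    unfolding unit_step_def using f by auto
  ultimately have "(unit_step F\<alpha>)\<^sup>+\<^sup>+ (0, \<gamma>\<alpha> 0) (t1, q)"
    using g\<alpha>(3) by (meson rtranclp_into_tranclp1 rtranclp.rtrancl_into_rtrancl)
  then have "tack_time F\<alpha> A q \<le> t1"
    unfolding tack_time_def using \<gamma>\<alpha>(2) by (intro minimal_arrival_time_le) auto
  also note t1
  also have "t0 + \<rho> * (a' * \<delta> + \<eta>) < t0 + \<rho> * (b' * \<delta>)"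
    using \<eta>(3) \<rho>(1) by simp
  \<comment> \<open>The right-hand side is the second clock at \<open>t0\<close>, for
    \<open>r = t0 + \<delta>\<close> and \<open>h = 0\<close>. At \<open>t0 + \<delta>\<close> that
    clock shows \<open>t0 + \<delta>\<close> itself, so the dragged second leg rejoins the old path
    strictly early.\<close>
  finally have tq: "tack_time F\<alpha> A q < t0 + \<rho> * (- b' * (t0 - (t0 + \<delta>)) + 0)" by simp
  obtain t2 f' where t2: "t2 < t0 + \<delta>"
    and f': "unit_arc F\<beta> f' (tack_time F\<alpha> A q) t2" "f' (tack_time F\<alpha> A q) = q" "f' t2 = g\<beta> (t0 + \<delta>)"
    using var2[OF _ _ _ _ _ _ _ \<rho>(1,3) tq, of "t0 + \<delta>"] \<delta> \<open>\<delta> > 0\<close> e2 by (auto simp: q_def p\<beta>)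
  have "unit_step F\<beta> (t0 + \<delta>, g\<beta> (t0 + \<delta>)) (r1, \<gamma>\<beta> r1)"
    unfolding unit_step_def using unit_arc_subinterval[OF g\<beta>(1), of "t0 + \<delta>" r1] \<delta> \<open>\<delta> > 0\<close> r g\<beta>(2)
    by (intro exI[of _ g\<beta>]) auto
  then have "(unit_step F\<beta>)\<^sup>*\<^sup>* (t0 + \<delta>, g\<beta> (t0 + \<delta>)) (T, \<gamma>\<beta> T)"
    using g\<beta>(3) by (rule converse_rtranclp_into_rtranclp)
  from unit_chain_depart_earlier[OF \<beta> this, of t2] t2 obtain T' where
    T': "T' < T" "(unit_step F\<beta>)\<^sup>*\<^sup>* (t2, g\<beta> (t0 + \<delta>)) (T', \<gamma>\<beta> T)" by auto
  have "unit_step F\<beta> (tack_time F\<alpha> A q, q) (t2, g\<beta> (t0 + \<delta>))"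
    unfolding unit_step_def using f' by auto
  then have "(unit_step F\<beta>)\<^sup>+\<^sup>+ (tack_time F\<alpha> A q, q) (T', \<gamma>\<beta> T)"
    using T'(2) by (rule rtranclp_into_tranclp2)
  then have "total_time F\<alpha> F\<beta> A B q \<le> T'"
    unfolding total_time_def using \<gamma>\<beta>(3) by (intro minimal_arrival_time_le) auto
  then show False using opt T T'(1) unfolding optimal_tack_point_def by (metis leD order_trans)
qed

theorem theorem5p12:
  fixes F\<alpha> F\<beta> :: "real \<Rightarrow> real ^ 'n \<Rightarrow> real ^ 'n \<Rightarrow> real"
    and A B \<eta> :: "(real ^ 'n) set"
    and p :: "real ^ 'n"
    and t0 T :: real
    and \<gamma>\<alpha> \<gamma>\<beta> :: "real \<Rightarrow> real ^ 'n"
  assumes "CARD('n) \<ge> 2"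
    and "time_dependent_finsler F\<alpha>" and "finsler_bounds F\<alpha>"
    and "time_dependent_finsler F\<beta>" and "finsler_bounds F\<beta>"
    and "admissible_region A" and "admissible_region B" and "A \<inter> B = {}"
    and "optimal_tack_point F\<alpha> F\<beta> A B p"
    and "t0 = tack_time F\<alpha> A p" and "T = total_time F\<alpha> F\<beta> A B p"
    and "trajectory F\<alpha> \<gamma>\<alpha> 0 t0" and "\<gamma>\<alpha> 0 \<in> A" and "\<gamma>\<alpha> t0 = p"
    and "trajectory F\<beta> \<gamma>\<beta> t0 T" and "\<gamma>\<beta> t0 = p" and "\<gamma>\<beta> T \<in> B"
    and "interface_divides \<eta> p (\<gamma>\<alpha> ` {0..t0}) (\<gamma>\<beta> ` {t0..T})"
  shows "\<forall>u \<in> tangent_space \<eta> p.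
    (\<Sum>i\<in>UNIV. (partial_deriv i (F\<alpha> t0 p) (vector_derivative \<gamma>\<alpha> (at t0 within {0..t0}))
             - partial_deriv i (F\<beta> t0 p) (vector_derivative \<gamma>\<beta> (at t0 within {t0..T}))) * u $ i) = 0"
proof
  fix u
  obtain r0 g\<alpha> where r0: "0 \<le> r0" and chain\<alpha>: "(unit_step F\<alpha>)\<^sup>*\<^sup>* (0, \<gamma>\<alpha> 0) (r0, \<gamma>\<alpha> r0)"
    and g\<alpha>1: "unit_arc F\<alpha> g\<alpha> r0 t0" and g\<alpha>2: "\<forall>t\<in>{r0..t0}. \<gamma>\<alpha> t = g\<alpha> t"
    by (rule trajectory_last_arc[OF assms(2,12)]) (rule that)
  note g\<alpha> = g\<alpha>1 bspec[OF g\<alpha>2]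
  obtain r1 g\<beta> where g\<beta>1: "unit_arc F\<beta> g\<beta> t0 r1" and r1: "r1 \<le> T"
    and chain\<beta>: "(unit_step F\<beta>)\<^sup>*\<^sup>* (r1, \<gamma>\<beta> r1) (T, \<gamma>\<beta> T)"
    and g\<beta>2: "\<forall>t\<in>{t0..r1}. \<gamma>\<beta> t = g\<beta> t"
    by (rule trajectory_first_arc[OF assms(4,15)]) (rule that)
  note g\<beta> = g\<beta>1 bspec[OF g\<beta>2]
  have r: "r0 < t0" "t0 < r1" using g\<alpha>(1) g\<beta>(1) by (auto simp: unit_arc_def)
  let ?v = "vector_derivative g\<alpha> (at t0)" and ?w = "vector_derivative g\<beta> (at t0)"
  have nz: "?v \<noteq> 0" "?w \<noteq> 0" using g\<alpha>(1) g\<beta>(1) r by (auto simp: unit_arc_def)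
  \<comment> \<open>The one-sided velocity at the end of the leg is the two-sided derivative of the
    last arc, since the two curves agree on \<open>{r0..t0}\<close>. The outgoing velocity is
    treated in the same way below.\<close>
  have "(\<gamma>\<alpha> has_vector_derivative ?v) (at t0 within {0..t0})"
  proof -
    have "(g\<alpha> has_vector_derivative ?v) (at t0 within {0..t0})"
      by (rule has_vector_derivative_at_within[OF unit_arc_has_vector_derivative[OF g\<alpha>(1)]]) (use r in auto)
    then show ?thesis
      by (rule has_vector_derivative_transform_within[where d="t0 - r0"])
        (use r r0 g\<alpha>(2) in \<open>auto simp: dist_real_def\<close>)
  qed
  then have v: "vector_derivative \<gamma>\<alpha> (at t0 within {0..t0}) = ?v"
    using r r0 by (intro vector_derivative_within_ivl) auto
  have "(\<gamma>\<beta> has_vector_derivative ?w) (at t0 within {t0..T})"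
  proof -
    have "(g\<beta> has_vector_derivative ?w) (at t0 within {t0..T})"
      by (rule has_vector_derivative_at_within[OF unit_arc_has_vector_derivative[OF g\<beta>(1)]]) (use r in auto)
    then show ?thesis
      by (rule has_vector_derivative_transform_within[where d="r1 - t0"])
        (use r r1 g\<beta>(2) in \<open>auto simp: dist_real_def\<close>)
  qed
  then have w: "vector_derivative \<gamma>\<beta> (at t0 within {t0..T}) = ?w"
    using r r1 by (intro vector_derivative_within_ivl) auto
  have le: "momentum F\<beta> t0 p ?w u \<le> momentum F\<alpha> t0 p ?v u" for u
    by (rule optimal_tack_momentum_le[OF assms(2-5,9,11-17) g\<alpha> chain\<alpha> g\<beta> chain\<beta>])
  have "momentum F\<alpha> t0 p ?v u = momentum F\<beta> t0 p ?w u"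
    using le[of u] le[of "- u"] linear_neg[OF linear_momentum[OF assms(2) nz(1)], of t0 p u]
      linear_neg[OF linear_momentum[OF assms(4) nz(2)], of t0 p u] by simp
  then show "(\<Sum>i\<in>UNIV. (partial_deriv i (F\<alpha> t0 p) (vector_derivative \<gamma>\<alpha> (at t0 within {0..t0}))
             - partial_deriv i (F\<beta> t0 p) (vector_derivative \<gamma>\<beta> (at t0 within {t0..T}))) * u $ i) = 0"
    unfolding v w
    by (simp add: left_diff_distrib sum_subtractf sum_partial_deriv_finsler[OF assms(2) nz(1)]
        sum_partial_deriv_finsler[OF assms(4) nz(2)])
qed

end
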